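(* Let $R$ be a commutative ring with unit. In the category $\mathbf{Lie}_R$ of Lie algebras over $R$, weak crossed squares are the same as crossed squares. That is, for a commutative square of $R$-Lie algebras $p_M\colon P\to M$, $p_N\colon P\to N$, $\mu\colon M\to L$, $\nu\colon N\to L$ with $\mu\circ p_M=\nu\circ p_N$, together with Lie actions of $L$ on $M$, $N$ and $P$, the Lie algebra version of the definition of weak crossed square (involving a Lie algebra morphism $h\colon M\otimes N\to P$) coincides with the definition of crossed square of Lie algebras (involving a function $h\colon M\times N\to P$), the two maps denoted $h$ corresponding to each other through $h(m\otimes n)=h(m,n)$.
   Context: Given a commutative square as in the claim with Lie actions of $L$ on $M,N,P$, the Lie algebras $M$ and $N$ act on each other and on $P$ via $\mu$ and $\nu$. Put $\lambda=\mu p_M=\nu p_N$. Crossed square of Lie algebras. A function $h\colon M\times N\to P$ is given such that, for all $l\in L$, $m,m'\in M$, $n,n'\in N$, $p\in P$: (X.0) $h$ is bilinear and $h([m,m'],n)={}^mh(m',n)-{}^{m'}h(m,n)$, $h(m,[n,n'])={}^nh(m,n')-{}^{n'}h(m,n)$; (X.1) $p_M$ and $p_N$ are $L$-equivariant, and $\mu\colon M\to L$, $\nu\colon N\to L$, $\lambda\colon P\to L$ with the given actions are crossed modules; (X.2) $p_M(h(m,n))=-{}^nm$ and $p_N(h(m,n))={}^mn$; (X.3) $h(p_M(p),n)=-{}^np$ and $h(m,p_N(p))={}^mp$; (X.4) ${}^lh(m,n)=h({}^lm,n)+h(m,{}^ln)$. These are known to be the same as internal crossed squares in $\mathbf{Lie}_R$,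 i.e. internal crossed modules in the category of crossed modules of Lie algebras. Tensor product. For crossed modules of Lie algebras $\mu\colon M\to L$, $\nu\colon N\to L$, the general categorical non-abelian tensor product (the upper left object of the initial crossed square over $\mu$ and $\nu$) is, in $\mathbf{Lie}_R$, Ellis's tensor product $M\otimes N$: the Lie algebra generated by symbols $m\otimes n$, $R$-bilinear in $m$ and $n$, with relations $[m,m']\otimes n=m\otimes({}^{m'}n)-m'\otimes({}^mn)$, $m\otimes[n,n']=({}^{n'}m)\otimes n-({}^nm)\otimes n'$, and $[m\otimes n,m'\otimes n']=-({}^nm)\otimes({}^{m'}n')$. Its projections are $\pi_M^{M\otimes N}(m\otimes n)=-{}^nm$ and $\pi_N^{M\otimes N}(m\otimes n)={}^mn$; $L$ acts on it by ${}^l(m\otimes n)=({}^lm)\otimes n+m\otimes({}^ln)$; it is a bifunctor on $L$-crossed modules with $(f\otimes g)(m\otimes n)=f(m)\otimes g(n)$. Weak crossed square (in $\mathbf{Lie}_R$). A Lie algebra morphism $h\colon M\otimes N\to P$ is given such that: (W.1) $p_M$ and $p_N$ are $L$-equivariant, and $\mu$, $\nu$, $\lambda$ with the given actions are $L$-crossed modules; (W.2) $p_M\circ h=\pi_M^{M\otimes N}$ and $p_N\circ h=\pi_N^{M\otimes N}$; (W.3) $h\circ(p_M\otimes 1_N)=\pi_P^{P\otimes N}\colon P\otimes N\to P$ and $h\circ(1_M\otimes p_N)=\pi_P^{M\otimes P}\colon M\otimes P\to P$, where the tensor products are those of the $L$-crossed modules $\lambda,\nu$, respectively $\mu,\lambda$;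 (W.4) $h$ is equivariant with respect to the actions of $L$ on $M\otimes N$ and $P$. *)

theory Defs
  imports "HOL-Algebra.Module"
begin

section \<open>Lie algebras, actions and crossed modules over a commutative ring\<close>

text \<open>The record \<open>module\<close> of HOL-Algebra inherits the ring fields \<open>mult\<close> and \<open>one\<close>. As for modules,
  they carry no meaning here; the bracket is a field of its own.\<close>

record ('r, 'a) lie_algebra = "('r, 'a) module" +
  bracket :: "'a \<Rightarrow> 'a \<Rightarrow> 'a"  ("\<lbrace>_, _\<rbrace>\<index>")

locale lie_algebra = module R L for R (structure) and L (structure) +
  assumes bracket_closed:
      "\<lbrakk>x \<in> carrier L; y \<in> carrier L\<rbrakk> \<Longrightarrow> \<lbrace>x, y\<rbrace>\<^bsub>L\<^esub> \<in> carrier L"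
    and bracket_add_left:
      "\<lbrakk>x \<in> carrier L; y \<in> carrier L; z \<in> carrier L\<rbrakk> \<Longrightarrow>
        \<lbrace>x \<oplus>\<^bsub>L\<^esub> y, z\<rbrace>\<^bsub>L\<^esub> = \<lbrace>x, z\<rbrace>\<^bsub>L\<^esub> \<oplus>\<^bsub>L\<^esub> \<lbrace>y, z\<rbrace>\<^bsub>L\<^esub>"
    and bracket_add_right:
      "\<lbrakk>x \<in> carrier L; y \<in> carrier L; z \<in> carrier L\<rbrakk> \<Longrightarrow>
        \<lbrace>x, y \<oplus>\<^bsub>L\<^esub> z\<rbrace>\<^bsub>L\<^esub> = \<lbrace>x, y\<rbrace>\<^bsub>L\<^esub> \<oplus>\<^bsub>L\<^esub> \<lbrace>x, z\<rbrace>\<^bsub>L\<^esub>"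
    and bracket_smult_left:
      "\<lbrakk>r \<in> carrier R; x \<in> carrier L; y \<in> carrier L\<rbrakk> \<Longrightarrow>
        \<lbrace>r \<odot>\<^bsub>L\<^esub> x, y\<rbrace>\<^bsub>L\<^esub> = r \<odot>\<^bsub>L\<^esub> \<lbrace>x, y\<rbrace>\<^bsub>L\<^esub>"
    and bracket_smult_right:
      "\<lbrakk>r \<in> carrier R; x \<in> carrier L; y \<in> carrier L\<rbrakk> \<Longrightarrow>
        \<lbrace>x, r \<odot>\<^bsub>L\<^esub> y\<rbrace>\<^bsub>L\<^esub> = r \<odot>\<^bsub>L\<^esub> \<lbrace>x, y\<rbrace>\<^bsub>L\<^esub>"
    and bracket_alternating:
      "x \<in> carrier L \<Longrightarrow> \<lbrace>x, x\<rbrace>\<^bsub>L\<^esub> = \<zero>\<^bsub>L\<^esub>"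
    and jacobi:
      "\<lbrakk>x \<in> carrier L; y \<in> carrier L; z \<in> carrier L\<rbrakk> \<Longrightarrow>
        \<lbrace>x, \<lbrace>y, z\<rbrace>\<^bsub>L\<^esub>\<rbrace>\<^bsub>L\<^esub> \<oplus>\<^bsub>L\<^esub> \<lbrace>y, \<lbrace>z, x\<rbrace>\<^bsub>L\<^esub>\<rbrace>\<^bsub>L\<^esub>
          \<oplus>\<^bsub>L\<^esub> \<lbrace>z, \<lbrace>x, y\<rbrace>\<^bsub>L\<^esub>\<rbrace>\<^bsub>L\<^esub> = \<zero>\<^bsub>L\<^esub>"

definition lie_hom ::
  "('r, 'u) ring_scheme \<Rightarrow> ('r, 'a, 'v) lie_algebra_scheme \<Rightarrow> ('r, 'b, 'w) lie_algebra_scheme \<Rightarrow> ('a \<Rightarrow> 'b) set"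
  where
  "lie_hom R A B =
    {f. f \<in> carrier A \<rightarrow> carrier B \<and>
        (\<forall>x \<in> carrier A. \<forall>y \<in> carrier A. f (x \<oplus>\<^bsub>A\<^esub> y) = f x \<oplus>\<^bsub>B\<^esub> f y) \<and>
        (\<forall>r \<in> carrier R. \<forall>x \<in> carrier A. f (r \<odot>\<^bsub>A\<^esub> x) = r \<odot>\<^bsub>B\<^esub> f x) \<and>
        (\<forall>x \<in> carrier A. \<forall>y \<in> carrier A. f \<lbrace>x, y\<rbrace>\<^bsub>A\<^esub> = \<lbrace>f x, f y\<rbrace>\<^bsub>B\<^esub>)}"

text \<open>An action of \<open>L\<close> on \<open>M\<close> is a function \<open>act\<close>, with \<open>act l m\<close> standing for \<open>l\<close> acting on \<open>m\<close>.\<close>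

locale lie_action = L?: lie_algebra R L + M?: lie_algebra R M
  for R (structure) and L (structure) and M (structure) +
  fixes act :: "'l \<Rightarrow> 'm \<Rightarrow> 'm"
  constrains L :: "('r, 'l, 'v) lie_algebra_scheme" and M :: "('r, 'm, 'w) lie_algebra_scheme"
  assumes act_closed:
      "\<lbrakk>l \<in> carrier L; m \<in> carrier M\<rbrakk> \<Longrightarrow> act l m \<in> carrier M"
    and act_add_left:
      "\<lbrakk>l \<in> carrier L; l' \<in> carrier L; m \<in> carrier M\<rbrakk> \<Longrightarrow>
        act (l \<oplus>\<^bsub>L\<^esub> l') m = act l m \<oplus>\<^bsub>M\<^esub> act l' m"
    and act_add_right:
      "\<lbrakk>l \<in> carrier L; m \<in> carrier M; m' \<in> carrier M\<rbrakk> \<Longrightarrow>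
        act l (m \<oplus>\<^bsub>M\<^esub> m') = act l m \<oplus>\<^bsub>M\<^esub> act l m'"
    and act_smult_left:
      "\<lbrakk>r \<in> carrier R; l \<in> carrier L; m \<in> carrier M\<rbrakk> \<Longrightarrow> act (r \<odot>\<^bsub>L\<^esub> l) m = r \<odot>\<^bsub>M\<^esub> act l m"
    and act_smult_right:
      "\<lbrakk>r \<in> carrier R; l \<in> carrier L; m \<in> carrier M\<rbrakk> \<Longrightarrow> act l (r \<odot>\<^bsub>M\<^esub> m) = r \<odot>\<^bsub>M\<^esub> act l m"
    and act_bracket_left:
      "\<lbrakk>l \<in> carrier L; l' \<in> carrier L; m \<in> carrier M\<rbrakk> \<Longrightarrow>
        act \<lbrace>l, l'\<rbrace>\<^bsub>L\<^esub> m = act l (act l' m) \<ominus>\<^bsub>M\<^esub> act l' (act l m)"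
    and act_bracket_right:
      "\<lbrakk>l \<in> carrier L; m \<in> carrier M; m' \<in> carrier M\<rbrakk> \<Longrightarrow>
        act l \<lbrace>m, m'\<rbrace>\<^bsub>M\<^esub> = \<lbrace>act l m, m'\<rbrace>\<^bsub>M\<^esub> \<oplus>\<^bsub>M\<^esub> \<lbrace>m, act l m'\<rbrace>\<^bsub>M\<^esub>"

locale lie_crossed_module = lie_action R L M act
  for R (structure) and L (structure) and M (structure) and act +
  fixes bd :: "'m \<Rightarrow> 'l"
  constrains L :: "('r, 'l, 'v) lie_algebra_scheme" and M :: "('r, 'm, 'w) lie_algebra_scheme"
    and act :: "'l \<Rightarrow> 'm \<Rightarrow> 'm"
  assumes bd_hom: "bd \<in> lie_hom R M L"
    and bd_equivariant:
      "\<lbrakk>l \<in> carrier L; m \<in> carrier M\<rbrakk> \<Longrightarrow> bd (act l m) = \<lbrace>l, bd m\<rbrace>\<^bsub>L\<^esub>"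
    and peiffer:
      "\<lbrakk>m \<in> carrier M; m' \<in> carrier M\<rbrakk> \<Longrightarrow> act (bd m) m' = \<lbrace>m, m'\<rbrace>\<^bsub>M\<^esub>"

definition lie_equivariant ::
  "('r, 'l, 'v) lie_algebra_scheme \<Rightarrow> ('r, 'a, 'w) lie_algebra_scheme \<Rightarrow> ('l \<Rightarrow> 'a \<Rightarrow> 'a) \<Rightarrow>
    ('l \<Rightarrow> 'b \<Rightarrow> 'b) \<Rightarrow> ('a \<Rightarrow> 'b) \<Rightarrow> bool"
  where
  "lie_equivariant L A actA actB f \<longleftrightarrow>
    (\<forall>l \<in> carrier L. \<forall>x \<in> carrier A. f (actA l x) = actB l (f x))"


section \<open>Lie algebras given by generators and relations\<close>

datatype ('r, 'g) lie_term =
    Gen 'g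
  | Zero
  | Neg "('r, 'g) lie_term"
  | Plus "('r, 'g) lie_term" "('r, 'g) lie_term"
  | Scale 'r "('r, 'g) lie_term"
  | Brack "('r, 'g) lie_term" "('r, 'g) lie_term"

inductive_set lie_terms :: "('r, 'u) ring_scheme \<Rightarrow> 'g set \<Rightarrow> ('r, 'g) lie_term set"
  for R :: "('r, 'u) ring_scheme" and X :: "'g set" where
  gen: "g \<in> X \<Longrightarrow> Gen g \<in> lie_terms R X"
| zero: "Zero \<in> lie_terms R X"
| neg: "t \<in> lie_terms R X \<Longrightarrow> Neg t \<in> lie_terms R X"
| plus: "\<lbrakk>s \<in> lie_terms R X; t \<in> lie_terms R X\<rbrakk> \<Longrightarrow> Plus s t \<in> lie_terms R X"
| scale: "\<lbrakk>r \<in> carrier R; t \<in> lie_terms R X\<rbrakk> \<Longrightarrow> Scale r t \<in> lie_terms R X"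
| brack: "\<lbrakk>s \<in> lie_terms R X; t \<in> lie_terms R X\<rbrakk> \<Longrightarrow> Brack s t \<in> lie_terms R X"

text \<open>The least congruence on the terms over \<open>X\<close> that contains the relations \<open>E\<close> and all instances
  of the axioms of a Lie algebra over \<open>R\<close>.\<close>

inductive_set lie_cong ::
  "('r, 'u) ring_scheme \<Rightarrow> 'g set \<Rightarrow> ('r, 'g) lie_term rel \<Rightarrow> ('r, 'g) lie_term rel"
  for R :: "('r, 'u) ring_scheme" and X :: "'g set" and E :: "('r, 'g) lie_term rel" where
  rel: "\<lbrakk>(s, t) \<in> E; s \<in> lie_terms R X; t \<in> lie_terms R X\<rbrakk> \<Longrightarrow> (s, t) \<in> lie_cong R X E"
| refl: "t \<in> lie_terms R X \<Longrightarrow> (t, t) \<in> lie_cong R X E"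
| sym: "(s, t) \<in> lie_cong R X E \<Longrightarrow> (t, s) \<in> lie_cong R X E"
| trans: "\<lbrakk>(s, t) \<in> lie_cong R X E; (t, u) \<in> lie_cong R X E\<rbrakk> \<Longrightarrow> (s, u) \<in> lie_cong R X E"
| cong_neg: "(s, t) \<in> lie_cong R X E \<Longrightarrow> (Neg s, Neg t) \<in> lie_cong R X E"
| cong_plus:
    "\<lbrakk>(s, s') \<in> lie_cong R X E; (t, t') \<in> lie_cong R X E\<rbrakk> \<Longrightarrow>
      (Plus s t, Plus s' t') \<in> lie_cong R X E"
| cong_scale:
    "\<lbrakk>r \<in> carrier R; (s, t) \<in> lie_cong R X E\<rbrakk> \<Longrightarrow> (Scale r s, Scale r t) \<in> lie_cong R X E"
| cong_brack:
    "\<lbrakk>(s, s') \<in> lie_cong R X E; (t, t') \<in> lie_cong R X E\<rbrakk> \<Longrightarrow>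
      (Brack s t, Brack s' t') \<in> lie_cong R X E"
| plus_assoc:
    "\<lbrakk>s \<in> lie_terms R X; t \<in> lie_terms R X; u \<in> lie_terms R X\<rbrakk> \<Longrightarrow>
      (Plus (Plus s t) u, Plus s (Plus t u)) \<in> lie_cong R X E"
| plus_comm:
    "\<lbrakk>s \<in> lie_terms R X; t \<in> lie_terms R X\<rbrakk> \<Longrightarrow> (Plus s t, Plus t s) \<in> lie_cong R X E"
| plus_zero: "t \<in> lie_terms R X \<Longrightarrow> (Plus Zero t, t) \<in> lie_cong R X E"
| plus_neg: "t \<in> lie_terms R X \<Longrightarrow> (Plus (Neg t) t, Zero) \<in> lie_cong R X E"
| scale_add_left:
    "\<lbrakk>q \<in> carrier R; r \<in> carrier R; t \<in> lie_terms R X\<rbrakk> \<Longrightarrow>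
      (Scale (q \<oplus>\<^bsub>R\<^esub> r) t, Plus (Scale q t) (Scale r t)) \<in> lie_cong R X E"
| scale_add_right:
    "\<lbrakk>r \<in> carrier R; s \<in> lie_terms R X; t \<in> lie_terms R X\<rbrakk> \<Longrightarrow>
      (Scale r (Plus s t), Plus (Scale r s) (Scale r t)) \<in> lie_cong R X E"
| scale_mult:
    "\<lbrakk>q \<in> carrier R; r \<in> carrier R; t \<in> lie_terms R X\<rbrakk> \<Longrightarrow>
      (Scale (q \<otimes>\<^bsub>R\<^esub> r) t, Scale q (Scale r t)) \<in> lie_cong R X E"
| scale_one: "t \<in> lie_terms R X \<Longrightarrow> (Scale \<one>\<^bsub>R\<^esub> t, t) \<in> lie_cong R X E"
| brack_add_left:
    "\<lbrakk>s \<in> lie_terms R X; t \<in> lie_terms R X; u \<in> lie_terms R X\<rbrakk> \<Longrightarrow>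
      (Brack (Plus s t) u, Plus (Brack s u) (Brack t u)) \<in> lie_cong R X E"
| brack_add_right:
    "\<lbrakk>s \<in> lie_terms R X; t \<in> lie_terms R X; u \<in> lie_terms R X\<rbrakk> \<Longrightarrow>
      (Brack s (Plus t u), Plus (Brack s t) (Brack s u)) \<in> lie_cong R X E"
| brack_scale_left:
    "\<lbrakk>r \<in> carrier R; s \<in> lie_terms R X; t \<in> lie_terms R X\<rbrakk> \<Longrightarrow>
      (Brack (Scale r s) t, Scale r (Brack s t)) \<in> lie_cong R X E"
| brack_scale_right:
    "\<lbrakk>r \<in> carrier R; s \<in> lie_terms R X; t \<in> lie_terms R X\<rbrakk> \<Longrightarrow>
      (Brack s (Scale r t), Scale r (Brack s t)) \<in> lie_cong R X E"
| brack_alternating: "t \<in> lie_terms R X \<Longrightarrow> (Brack t t, Zero) \<in> lie_cong R X E"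
| brack_jacobi:
    "\<lbrakk>s \<in> lie_terms R X; t \<in> lie_terms R X; u \<in> lie_terms R X\<rbrakk> \<Longrightarrow>
      (Plus (Plus (Brack s (Brack t u)) (Brack t (Brack u s))) (Brack u (Brack s t)), Zero)
        \<in> lie_cong R X E"

definition lie_presented ::
  "('r, 'u) ring_scheme \<Rightarrow> 'g set \<Rightarrow> ('r, 'g) lie_term rel \<Rightarrow> ('r, ('r, 'g) lie_term set) lie_algebra"
  where
  "lie_presented R X E =
    \<lparr>carrier = lie_terms R X // lie_cong R X E,
     mult = undefined,
     one = undefined,
     zero = lie_cong R X E `` {Zero},
     add = (\<lambda>A B. \<Union>s \<in> A. \<Union>t \<in> B. lie_cong R X E `` {Plus s t}),
     smult = (\<lambda>r A. \<Union>t \<in> A. lie_cong R X E `` {Scale r t}),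
     bracket = (\<lambda>A B. \<Union>s \<in> A. \<Union>t \<in> B. lie_cong R X E `` {Brack s t})\<rparr>"

fun lie_eval :: "('r, 'a, 'v) lie_algebra_scheme \<Rightarrow> ('g \<Rightarrow> 'a) \<Rightarrow> ('r, 'g) lie_term \<Rightarrow> 'a" where
  "lie_eval A f (Gen g) = f g"
| "lie_eval A f Zero = \<zero>\<^bsub>A\<^esub>"
| "lie_eval A f (Neg t) = \<ominus>\<^bsub>A\<^esub> lie_eval A f t"
| "lie_eval A f (Plus s t) = lie_eval A f s \<oplus>\<^bsub>A\<^esub> lie_eval A f t"
| "lie_eval A f (Scale r t) = r \<odot>\<^bsub>A\<^esub> lie_eval A f t"
| "lie_eval A f (Brack s t) = \<lbrace>lie_eval A f s, lie_eval A f t\<rbrace>\<^bsub>A\<^esub>"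

text \<open>The Lie algebra morphism into \<open>A\<close> that extends the map \<open>f\<close> on generators, as a function on
  congruence classes of terms; meaningful when \<open>f\<close> respects the relations of the presentation.\<close>

definition lie_lift ::
  "('r, 'a, 'v) lie_algebra_scheme \<Rightarrow> ('g \<Rightarrow> 'a) \<Rightarrow> ('r, 'g) lie_term set \<Rightarrow> 'a" where
  "lie_lift A f C = the_elem (lie_eval A f ` C)"

text \<open>The derivation on terms that extends the map \<open>d\<close> on generators.\<close>

fun lie_term_deriv :: "('g \<Rightarrow> ('r, 'g) lie_term) \<Rightarrow> ('r, 'g) lie_term \<Rightarrow> ('r, 'g) lie_term" where
  "lie_term_deriv d (Gen g) = d g"
| "lie_term_deriv d Zero = Zero"
| "lie_term_deriv d (Neg t) = Neg (lie_term_deriv d t)"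
| "lie_term_deriv d (Plus s t) = Plus (lie_term_deriv d s) (lie_term_deriv d t)"
| "lie_term_deriv d (Scale r t) = Scale r (lie_term_deriv d t)"
| "lie_term_deriv d (Brack s t) = Plus (Brack (lie_term_deriv d s) t) (Brack s (lie_term_deriv d t))"


section \<open>The non-abelian tensor product\<close>

text \<open>In the following definitions the triples \<open>(M, aM, mu)\<close> and \<open>(N, aN, nu)\<close> are crossed modules
  over a common Lie algebra \<open>L\<close>. Thus \<open>m\<close> in \<open>M\<close> acts on \<open>N\<close> as \<open>aN (mu m)\<close>, and \<open>n\<close> in \<open>N\<close> acts
  on \<open>M\<close> as \<open>aM (nu n)\<close>.\<close>

inductive_set tensor_relations ::
  "('r, 'u) ring_scheme \<Rightarrow> ('r, 'm, 'v) lie_algebra_scheme \<Rightarrow> ('l \<Rightarrow> 'm \<Rightarrow> 'm) \<Rightarrow> ('m \<Rightarrow> 'l) \<Rightarrow>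
    ('r, 'n, 'w) lie_algebra_scheme \<Rightarrow> ('l \<Rightarrow> 'n \<Rightarrow> 'n) \<Rightarrow> ('n \<Rightarrow> 'l) \<Rightarrow> ('r, 'm \<times> 'n) lie_term rel"
  for R :: "('r, 'u) ring_scheme"
    and M :: "('r, 'm, 'v) lie_algebra_scheme" and aM :: "'l \<Rightarrow> 'm \<Rightarrow> 'm" and mu :: "'m \<Rightarrow> 'l"
    and N :: "('r, 'n, 'w) lie_algebra_scheme" and aN :: "'l \<Rightarrow> 'n \<Rightarrow> 'n" and nu :: "'n \<Rightarrow> 'l"
  where
  add_left:
    "\<lbrakk>m \<in> carrier M; m' \<in> carrier M; n \<in> carrier N\<rbrakk> \<Longrightarrow>
      (Gen (m \<oplus>\<^bsub>M\<^esub> m', n), Plus (Gen (m, n)) (Gen (m', n))) \<in> tensor_relations R M aM mu N aN nu"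
| add_right:
    "\<lbrakk>m \<in> carrier M; n \<in> carrier N; n' \<in> carrier N\<rbrakk> \<Longrightarrow>
      (Gen (m, n \<oplus>\<^bsub>N\<^esub> n'), Plus (Gen (m, n)) (Gen (m, n'))) \<in> tensor_relations R M aM mu N aN nu"
| smult_left:
    "\<lbrakk>r \<in> carrier R; m \<in> carrier M; n \<in> carrier N\<rbrakk> \<Longrightarrow>
      (Gen (r \<odot>\<^bsub>M\<^esub> m, n), Scale r (Gen (m, n))) \<in> tensor_relations R M aM mu N aN nu"
| smult_right:
    "\<lbrakk>r \<in> carrier R; m \<in> carrier M; n \<in> carrier N\<rbrakk> \<Longrightarrow>
      (Gen (m, r \<odot>\<^bsub>N\<^esub> n), Scale r (Gen (m, n))) \<in> tensor_relations R M aM mu N aN nu"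
| bracket_left:
    "\<lbrakk>m \<in> carrier M; m' \<in> carrier M; n \<in> carrier N\<rbrakk> \<Longrightarrow>
      (Gen (\<lbrace>m, m'\<rbrace>\<^bsub>M\<^esub>, n), Plus (Gen (m, aN (mu m') n)) (Neg (Gen (m', aN (mu m) n))))
        \<in> tensor_relations R M aM mu N aN nu"
| bracket_right:
    "\<lbrakk>m \<in> carrier M; n \<in> carrier N; n' \<in> carrier N\<rbrakk> \<Longrightarrow>
      (Gen (m, \<lbrace>n, n'\<rbrace>\<^bsub>N\<^esub>), Plus (Gen (aM (nu n') m, n)) (Neg (Gen (aM (nu n) m, n'))))
        \<in> tensor_relations R M aM mu N aN nu"
| bracket_gen:
    "\<lbrakk>m \<in> carrier M; n \<in> carrier N; m' \<in> carrier M; n' \<in> carrier N\<rbrakk> \<Longrightarrow>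
      (Brack (Gen (m, n)) (Gen (m', n')), Neg (Gen (aM (nu n) m, aN (mu m') n')))
        \<in> tensor_relations R M aM mu N aN nu"

abbreviation tensor_cong where
  "tensor_cong R M aM mu N aN nu \<equiv>
    lie_cong R (carrier M \<times> carrier N) (tensor_relations R M aM mu N aN nu)"

definition lie_tensor ::
  "('r, 'u) ring_scheme \<Rightarrow> ('r, 'm, 'v) lie_algebra_scheme \<Rightarrow> ('l \<Rightarrow> 'm \<Rightarrow> 'm) \<Rightarrow> ('m \<Rightarrow> 'l) \<Rightarrow>
    ('r, 'n, 'w) lie_algebra_scheme \<Rightarrow> ('l \<Rightarrow> 'n \<Rightarrow> 'n) \<Rightarrow> ('n \<Rightarrow> 'l) \<Rightarrow>
    ('r, ('r, 'm \<times> 'n) lie_term set) lie_algebra"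
  where
  "lie_tensor R M aM mu N aN nu =
    lie_presented R (carrier M \<times> carrier N) (tensor_relations R M aM mu N aN nu)"

definition tensor_elt ::
  "('r, 'u) ring_scheme \<Rightarrow> ('r, 'm, 'v) lie_algebra_scheme \<Rightarrow> ('l \<Rightarrow> 'm \<Rightarrow> 'm) \<Rightarrow> ('m \<Rightarrow> 'l) \<Rightarrow>
    ('r, 'n, 'w) lie_algebra_scheme \<Rightarrow> ('l \<Rightarrow> 'n \<Rightarrow> 'n) \<Rightarrow> ('n \<Rightarrow> 'l) \<Rightarrow>
    'm \<Rightarrow> 'n \<Rightarrow> ('r, 'm \<times> 'n) lie_term set"
  where
  "tensor_elt R M aM mu N aN nu m n = tensor_cong R M aM mu N aN nu `` {Gen (m, n)}"

definition tensor_proj1 ::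
  "('r, 'm, 'v) lie_algebra_scheme \<Rightarrow> ('l \<Rightarrow> 'm \<Rightarrow> 'm) \<Rightarrow> ('n \<Rightarrow> 'l) \<Rightarrow>
    ('r, 'm \<times> 'n) lie_term set \<Rightarrow> 'm"
  where
  "tensor_proj1 M aM nu = lie_lift M (\<lambda>(m, n). \<ominus>\<^bsub>M\<^esub> aM (nu n) m)"

definition tensor_proj2 ::
  "('r, 'n, 'w) lie_algebra_scheme \<Rightarrow> ('l \<Rightarrow> 'n \<Rightarrow> 'n) \<Rightarrow> ('m \<Rightarrow> 'l) \<Rightarrow>
    ('r, 'm \<times> 'n) lie_term set \<Rightarrow> 'n"
  where
  "tensor_proj2 N aN mu = lie_lift N (\<lambda>(m, n). aN (mu m) n)"

text \<open>The tensor product of morphisms \<open>f\<close> and \<open>g\<close>. The data \<open>(M, aM, mu)\<close> and \<open>(N, aN, nu)\<close> are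
  those of the codomain; the domain enters only through the argument, a congruence class of terms.\<close>

definition tensor_map ::
  "('r, 'u) ring_scheme \<Rightarrow> ('r, 'm, 'v) lie_algebra_scheme \<Rightarrow> ('l \<Rightarrow> 'm \<Rightarrow> 'm) \<Rightarrow> ('m \<Rightarrow> 'l) \<Rightarrow>
    ('r, 'n, 'w) lie_algebra_scheme \<Rightarrow> ('l \<Rightarrow> 'n \<Rightarrow> 'n) \<Rightarrow> ('n \<Rightarrow> 'l) \<Rightarrow>
    ('a \<Rightarrow> 'm) \<Rightarrow> ('b \<Rightarrow> 'n) \<Rightarrow> ('r, 'a \<times> 'b) lie_term set \<Rightarrow> ('r, 'm \<times> 'n) lie_term set"
  where
  "tensor_map R M aM mu N aN nu f g =
    lie_lift (lie_tensor R M aM mu N aN nu) (\<lambda>(x, y). tensor_elt R M aM mu N aN nu (f x) (g y))"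

definition tensor_act ::
  "('r, 'u) ring_scheme \<Rightarrow> ('r, 'm, 'v) lie_algebra_scheme \<Rightarrow> ('l \<Rightarrow> 'm \<Rightarrow> 'm) \<Rightarrow> ('m \<Rightarrow> 'l) \<Rightarrow>
    ('r, 'n, 'w) lie_algebra_scheme \<Rightarrow> ('l \<Rightarrow> 'n \<Rightarrow> 'n) \<Rightarrow> ('n \<Rightarrow> 'l) \<Rightarrow>
    'l \<Rightarrow> ('r, 'm \<times> 'n) lie_term set \<Rightarrow> ('r, 'm \<times> 'n) lie_term set"
  where
  "tensor_act R M aM mu N aN nu l C =
    (\<Union>t \<in> C. tensor_cong R M aM mu N aN nu ``
      {lie_term_deriv (\<lambda>(m, n). Plus (Gen (aM l m, n)) (Gen (m, aN l n))) t})"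


section \<open>Crossed squares and weak crossed squares\<close>

locale lie_square =
  actM: lie_action R L M aM + actN: lie_action R L N aN + actP: lie_action R L P aP
  for R :: "('r, 'u) ring_scheme"
    and L :: "('r, 'l, 'v) lie_algebra_scheme"
    and M :: "('r, 'm, 'w) lie_algebra_scheme"
    and N :: "('r, 'n, 'x) lie_algebra_scheme"
    and P :: "('r, 'p, 'y) lie_algebra_scheme"
    and aM aN aP +
  fixes mu :: "'m \<Rightarrow> 'l" and nu :: "'n \<Rightarrow> 'l" and pM :: "'p \<Rightarrow> 'm" and pN :: "'p \<Rightarrow> 'n"
  assumes mu_hom: "mu \<in> lie_hom R M L"
    and nu_hom: "nu \<in> lie_hom R N L"
    and pM_hom: "pM \<in> lie_hom R P M"
    and pN_hom: "pN \<in> lie_hom R P N"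
    and commutes: "p \<in> carrier P \<Longrightarrow> mu (pM p) = nu (pN p)"

text \<open>In both definitions the diagonal \<open>P \<rightarrow> L\<close> of the square is written \<open>mu \<circ> pM\<close>; elements of \<open>M\<close>
  and \<open>N\<close> act on \<open>M\<close>, \<open>N\<close> and \<open>P\<close> through \<open>mu\<close> and \<open>nu\<close>.\<close>

locale crossed_square = lie_square R L M N P aM aN aP mu nu pM pN
  for R :: "('r, 'u) ring_scheme"
    and L :: "('r, 'l, 'v) lie_algebra_scheme"
    and M :: "('r, 'm, 'w) lie_algebra_scheme"
    and N :: "('r, 'n, 'x) lie_algebra_scheme"
    and P :: "('r, 'p, 'y) lie_algebra_scheme"
    and aM aN aP mu nu pM pN +
  fixes h :: "'m \<times> 'n \<Rightarrow> 'p"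
  assumes h_closed: "h \<in> carrier M \<times> carrier N \<rightarrow> carrier P"
    and X0_add_left:
      "\<lbrakk>m \<in> carrier M; m' \<in> carrier M; n \<in> carrier N\<rbrakk> \<Longrightarrow>
        h (m \<oplus>\<^bsub>M\<^esub> m', n) = h (m, n) \<oplus>\<^bsub>P\<^esub> h (m', n)"
    and X0_add_right:
      "\<lbrakk>m \<in> carrier M; n \<in> carrier N; n' \<in> carrier N\<rbrakk> \<Longrightarrow>
        h (m, n \<oplus>\<^bsub>N\<^esub> n') = h (m, n) \<oplus>\<^bsub>P\<^esub> h (m, n')"
    and X0_smult_left:
      "\<lbrakk>r \<in> carrier R; m \<in> carrier M; n \<in> carrier N\<rbrakk> \<Longrightarrow> h (r \<odot>\<^bsub>M\<^esub> m, n) = r \<odot>\<^bsub>P\<^esub> h (m, n)"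
    and X0_smult_right:
      "\<lbrakk>r \<in> carrier R; m \<in> carrier M; n \<in> carrier N\<rbrakk> \<Longrightarrow> h (m, r \<odot>\<^bsub>N\<^esub> n) = r \<odot>\<^bsub>P\<^esub> h (m, n)"
    and X0_bracket_left:
      "\<lbrakk>m \<in> carrier M; m' \<in> carrier M; n \<in> carrier N\<rbrakk> \<Longrightarrow>
        h (\<lbrace>m, m'\<rbrace>\<^bsub>M\<^esub>, n) = aP (mu m) (h (m', n)) \<ominus>\<^bsub>P\<^esub> aP (mu m') (h (m, n))"
    and X0_bracket_right:
      "\<lbrakk>m \<in> carrier M; n \<in> carrier N; n' \<in> carrier N\<rbrakk> \<Longrightarrow>
        h (m, \<lbrace>n, n'\<rbrace>\<^bsub>N\<^esub>) = aP (nu n) (h (m, n')) \<ominus>\<^bsub>P\<^esub> aP (nu n') (h (m, n))"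
    and X1_equivariant: "lie_equivariant L P aP aM pM" "lie_equivariant L P aP aN pN"
    and X1_crossed_modules:
      "lie_crossed_module R L M aM mu" "lie_crossed_module R L N aN nu"
      "lie_crossed_module R L P aP (mu \<circ> pM)"
    and X2:
      "\<lbrakk>m \<in> carrier M; n \<in> carrier N\<rbrakk> \<Longrightarrow> pM (h (m, n)) = \<ominus>\<^bsub>M\<^esub> aM (nu n) m"
      "\<lbrakk>m \<in> carrier M; n \<in> carrier N\<rbrakk> \<Longrightarrow> pN (h (m, n)) = aN (mu m) n"
    and X3:
      "\<lbrakk>p \<in> carrier P; n \<in> carrier N\<rbrakk> \<Longrightarrow> h (pM p, n) = \<ominus>\<^bsub>P\<^esub> aP (nu n) p"
      "\<lbrakk>m \<in> carrier M; p \<in> carrier P\<rbrakk> \<Longrightarrow> h (m, pN p) = aP (mu m) p"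
    and X4:
      "\<lbrakk>l \<in> carrier L; m \<in> carrier M; n \<in> carrier N\<rbrakk> \<Longrightarrow>
        aP l (h (m, n)) = h (aM l m, n) \<oplus>\<^bsub>P\<^esub> h (m, aN l n)"

locale weak_crossed_square = lie_square R L M N P aM aN aP mu nu pM pN
  for R :: "('r, 'u) ring_scheme"
    and L :: "('r, 'l, 'v) lie_algebra_scheme"
    and M :: "('r, 'm, 'w) lie_algebra_scheme"
    and N :: "('r, 'n, 'x) lie_algebra_scheme"
    and P :: "('r, 'p, 'y) lie_algebra_scheme"
    and aM aN aP mu nu pM pN +
  fixes h :: "('r, 'm \<times> 'n) lie_term set \<Rightarrow> 'p"
  assumes h_hom: "h \<in> lie_hom R (lie_tensor R M aM mu N aN nu) P"
    and W1_equivariant: "lie_equivariant L P aP aM pM" "lie_equivariant L P aP aN pN"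
    and W1_crossed_modules:
      "lie_crossed_module R L M aM mu" "lie_crossed_module R L N aN nu"
      "lie_crossed_module R L P aP (mu \<circ> pM)"
    and W2:
      "t \<in> carrier (lie_tensor R M aM mu N aN nu) \<Longrightarrow> pM (h t) = tensor_proj1 M aM nu t"
      "t \<in> carrier (lie_tensor R M aM mu N aN nu) \<Longrightarrow> pN (h t) = tensor_proj2 N aN mu t"
    and W3:
      "u \<in> carrier (lie_tensor R P aP (mu \<circ> pM) N aN nu) \<Longrightarrow>
        h (tensor_map R M aM mu N aN nu pM id u) = tensor_proj1 P aP nu u"
      "v \<in> carrier (lie_tensor R M aM mu P aP (mu \<circ> pM)) \<Longrightarrow>
        h (tensor_map R M aM mu N aN nu id pN v) = tensor_proj2 P aP mu v"
    and W4:
      "lie_equivariant L (lie_tensor R M aM mu N aN nu) (tensor_act R M aM mu N aN nu) aP h"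

end

theory Submission
  imports Defs
begin

text \<open>A Lie algebra morphism out of \<open>M \<otimes> N\<close> is the same as a map on \<open>M \<times> N\<close> that respects the
  defining relations (a Lie pairing), and identities between morphisms, as well as equivariance, can
  be tested on the generators \<open>m \<otimes> n\<close>. So (W.2), (W.3), (W.4) amount to (X.2), (X.3), (X.4), and it
  remains to match (X.0) with the defining relations. Write \<open>x \<cdot> y\<close> for the action of \<open>x\<close> on \<open>y\<close>. As
  \<open>m \<cdot> m' = [m, m']\<close> in the crossed module \<open>M\<close>, (X.4) gives
  \<open>m \<cdot> h(m', n) - m' \<cdot> h(m, n) = 2 h([m, m'], n) + h(m', m \<cdot> n) - h(m, m' \<cdot> n)\<close>,
  so the left hand side is \<open>h([m, m'], n)\<close> if and only if
  \<open>h([m, m'], n) = h(m, m' \<cdot> n) - h(m', m \<cdot> n)\<close>; likewise on the other side. The relation for the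
  bracket of two generators follows from the Peiffer identity in \<open>P\<close> with (X.2) and (X.3).\<close>


section \<open>Lie algebras\<close>

context abelian_group
begin

lemma eq_diff_iff:
  assumes "x \<in> carrier G" "y \<in> carrier G" "z \<in> carrier G"
  shows "x = z \<ominus> y \<longleftrightarrow> x \<oplus> y = z"
  using assms by (auto simp: minus_eq a_assoc l_neg r_neg)

lemma diff_eq_iff:
  assumes "x \<in> carrier G" "y \<in> carrier G" "z \<in> carrier G"
  shows "z \<ominus> y = x \<longleftrightarrow> z = x \<oplus> y"
  using assms eq_diff_iff[of x y z] by auto

lemma add_diff:
  "\<lbrakk>x \<in> carrier G; y \<in> carrier G; z \<in> carrier G\<rbrakk> \<Longrightarrow> x \<oplus> (y \<ominus> z) = (x \<oplus> y) \<ominus> z"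
  by (simp add: minus_eq a_assoc)

lemma diff_add:
  "\<lbrakk>x \<in> carrier G; y \<in> carrier G; z \<in> carrier G\<rbrakk> \<Longrightarrow> (x \<ominus> y) \<oplus> z = (x \<oplus> z) \<ominus> y"
  by (simp add: minus_eq a_ac)

lemma diff_diff_left:
  "\<lbrakk>x \<in> carrier G; y \<in> carrier G; z \<in> carrier G\<rbrakk> \<Longrightarrow> (x \<ominus> y) \<ominus> z = x \<ominus> (y \<oplus> z)"
  by (simp add: minus_eq a_assoc minus_add)

lemma diff_diff_right:
  "\<lbrakk>x \<in> carrier G; y \<in> carrier G; z \<in> carrier G\<rbrakk> \<Longrightarrow> x \<ominus> (y \<ominus> z) = (x \<oplus> z) \<ominus> y"
  by (simp add: minus_eq a_ac minus_add)

lemma neg_diff: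
  "\<lbrakk>x \<in> carrier G; y \<in> carrier G\<rbrakk> \<Longrightarrow> \<ominus> (x \<ominus> y) = y \<ominus> x"
  by (simp add: minus_eq a_ac minus_add)

lemma diff_neg:
  "\<lbrakk>x \<in> carrier G; y \<in> carrier G\<rbrakk> \<Longrightarrow> x \<ominus> \<ominus> y = x \<oplus> y"
  by (simp add: minus_eq)

lemma add_neg:
  "\<lbrakk>x \<in> carrier G; y \<in> carrier G\<rbrakk> \<Longrightarrow> x \<oplus> \<ominus> y = x \<ominus> y"
  by (simp add: minus_eq)

lemma neg_add:
  "\<lbrakk>x \<in> carrier G; y \<in> carrier G\<rbrakk> \<Longrightarrow> \<ominus> y \<oplus> x = x \<ominus> y"
  by (simp add: minus_eq a_comm)

text \<open>Oriented so that subtracted terms move to the other side of an equation: identities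
  between signed sums become identities between plain sums, which \<open>a_ac\<close>
  settles.\<close>

lemmas diff_simps = eq_diff_iff diff_eq_iff add_diff diff_add diff_diff_left diff_diff_right
  neg_diff diff_neg add_neg neg_add

end

context lie_algebra
begin

lemma bracket_zero_left: "x \<in> carrier L \<Longrightarrow> \<lbrace>\<zero>\<^bsub>L\<^esub>, x\<rbrace>\<^bsub>L\<^esub> = \<zero>\<^bsub>L\<^esub>"
  using bracket_add_left[of "\<zero>\<^bsub>L\<^esub>" "\<zero>\<^bsub>L\<^esub>" x]
  by (simp add: bracket_closed M.add.r_cancel_one')

lemma bracket_zero_right: "x \<in> carrier L \<Longrightarrow> \<lbrace>x, \<zero>\<^bsub>L\<^esub>\<rbrace>\<^bsub>L\<^esub> = \<zero>\<^bsub>L\<^esub>"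
  using bracket_add_right[of x "\<zero>\<^bsub>L\<^esub>" "\<zero>\<^bsub>L\<^esub>"]
  by (simp add: bracket_closed M.add.r_cancel_one')

lemma bracket_neg_left:
  "\<lbrakk>x \<in> carrier L; y \<in> carrier L\<rbrakk> \<Longrightarrow> \<lbrace>\<ominus>\<^bsub>L\<^esub> x, y\<rbrace>\<^bsub>L\<^esub> = \<ominus>\<^bsub>L\<^esub> \<lbrace>x, y\<rbrace>\<^bsub>L\<^esub>"
  using bracket_add_left[of "\<ominus>\<^bsub>L\<^esub> x" x y]
  by (simp add: bracket_closed M.l_neg bracket_zero_left M.minus_equality)

lemma bracket_neg_right:
  "\<lbrakk>x \<in> carrier L; y \<in> carrier L\<rbrakk> \<Longrightarrow> \<lbrace>x, \<ominus>\<^bsub>L\<^esub> y\<rbrace>\<^bsub>L\<^esub> = \<ominus>\<^bsub>L\<^esub> \<lbrace>x, y\<rbrace>\<^bsub>L\<^esub>"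
  using bracket_add_right[of x "\<ominus>\<^bsub>L\<^esub> y" y]
  by (simp add: bracket_closed M.l_neg bracket_zero_right M.minus_equality)

text \<open>Polarization of \<open>bracket_alternating\<close>: expand the bracket of the sum of
  \<open>x\<close> and \<open>y\<close> with itself.\<close>

lemma bracket_antisym:
  assumes "x \<in> carrier L" "y \<in> carrier L"
  shows "\<lbrace>y, x\<rbrace>\<^bsub>L\<^esub> = \<ominus>\<^bsub>L\<^esub> \<lbrace>x, y\<rbrace>\<^bsub>L\<^esub>"
proof -
  have "\<lbrace>x \<oplus>\<^bsub>L\<^esub> y, x \<oplus>\<^bsub>L\<^esub> y\<rbrace>\<^bsub>L\<^esub> = \<lbrace>x, y\<rbrace>\<^bsub>L\<^esub> \<oplus>\<^bsub>L\<^esub> \<lbrace>y, x\<rbrace>\<^bsub>L\<^esub>"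
    using assms bracket_alternating[of x] bracket_alternating[of y]
    by (simp add: bracket_add_left bracket_add_right bracket_closed M.a_comm)
  moreover have "\<lbrace>x \<oplus>\<^bsub>L\<^esub> y, x \<oplus>\<^bsub>L\<^esub> y\<rbrace>\<^bsub>L\<^esub> = \<zero>\<^bsub>L\<^esub>"
    using assms by (simp add: bracket_alternating)
  ultimately have "\<lbrace>y, x\<rbrace>\<^bsub>L\<^esub> \<oplus>\<^bsub>L\<^esub> \<lbrace>x, y\<rbrace>\<^bsub>L\<^esub> = \<zero>\<^bsub>L\<^esub>"
    using assms by (simp add: bracket_closed M.a_comm)
  then show ?thesis
    using assms by (simp add: bracket_closed M.minus_equality)
qed

end

context lie_action
begin

lemma act_zero: "l \<in> carrier L \<Longrightarrow> act l \<zero>\<^bsub>M\<^esub> = \<zero>\<^bsub>M\<^esub>"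
  using act_add_right[of l "\<zero>\<^bsub>M\<^esub>" "\<zero>\<^bsub>M\<^esub>"] by (simp add: act_closed M.add.r_cancel_one')

lemma act_neg:
  "\<lbrakk>l \<in> carrier L; m \<in> carrier M\<rbrakk> \<Longrightarrow> act l (\<ominus>\<^bsub>M\<^esub> m) = \<ominus>\<^bsub>M\<^esub> act l m"
  using act_add_right[of l "\<ominus>\<^bsub>M\<^esub> m" m] by (simp add: act_closed M.l_neg act_zero M.minus_equality)

end

lemma lie_homD:
  assumes "f \<in> lie_hom R A B"
  shows "x \<in> carrier A \<Longrightarrow> f x \<in> carrier B"
    and "\<lbrakk>x \<in> carrier A; y \<in> carrier A\<rbrakk> \<Longrightarrow> f (x \<oplus>\<^bsub>A\<^esub> y) = f x \<oplus>\<^bsub>B\<^esub> f y"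
    and "\<lbrakk>r \<in> carrier R; x \<in> carrier A\<rbrakk> \<Longrightarrow> f (r \<odot>\<^bsub>A\<^esub> x) = r \<odot>\<^bsub>B\<^esub> f x"
    and "\<lbrakk>x \<in> carrier A; y \<in> carrier A\<rbrakk> \<Longrightarrow> f \<lbrace>x, y\<rbrace>\<^bsub>A\<^esub> = \<lbrace>f x, f y\<rbrace>\<^bsub>B\<^esub>"
  using assms unfolding lie_hom_def by auto

lemma lie_hom_zero:
  assumes "lie_algebra R A" "lie_algebra R B" "f \<in> lie_hom R A B"
  shows "f \<zero>\<^bsub>A\<^esub> = \<zero>\<^bsub>B\<^esub>"
proof -
  interpret A: lie_algebra R A by fact
  interpret B: lie_algebra R B by fact
  show ?thesis
    using lie_homD(2)[OF assms(3), of "\<zero>\<^bsub>A\<^esub>" "\<zero>\<^bsub>A\<^esub>"] lie_homD(1)[OF assms(3), of "\<zero>\<^bsub>A\<^esub>"]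
    by (simp add: B.M.add.r_cancel_one')
qed

lemma lie_hom_neg:
  assumes "lie_algebra R A" "lie_algebra R B" "f \<in> lie_hom R A B" "x \<in> carrier A"
  shows "f (\<ominus>\<^bsub>A\<^esub> x) = \<ominus>\<^bsub>B\<^esub> f x"
proof -
  interpret A: lie_algebra R A by fact
  interpret B: lie_algebra R B by fact
  show ?thesis
    using lie_homD(2)[OF assms(3), of "\<ominus>\<^bsub>A\<^esub> x" x] lie_homD(1)[OF assms(3)] assms(4)
      lie_hom_zero[OF assms(1-3)]
    by (simp add: A.M.l_neg B.M.minus_equality)
qed


section \<open>Presented Lie algebras\<close>

locale lie_presentation = cring R for R :: "('r, 'u) ring_scheme" (structure) +
  fixes X :: "'g set" and E :: "('r, 'g) lie_term rel"
begin

abbreviation terms where "terms \<equiv> lie_terms R X"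

definition cls :: "('r, 'g) lie_term \<Rightarrow> ('r, 'g) lie_term set"
  where "cls t = lie_cong R X E `` {t}"

lemma cong_terms: "(s, t) \<in> lie_cong R X E \<Longrightarrow> s \<in> terms \<and> t \<in> terms"
  by (induction rule: lie_cong.induct) (auto intro: lie_terms.intros)

lemma equiv_cong: "equiv terms (lie_cong R X E)"
proof (rule equivI)
  show "lie_cong R X E \<subseteq> terms \<times> terms"
    using cong_terms by auto
  show "refl_on terms (lie_cong R X E)"
    by (auto simp: refl_on_def intro: lie_cong.refl)
  show "sym (lie_cong R X E)"
    by (auto simp: sym_def intro: lie_cong.sym)
  show "trans (lie_cong R X E)"
    by (auto simp: trans_def intro: lie_cong.trans)
qed

lemma cls_eqI: "(s, t) \<in> lie_cong R X E \<Longrightarrow> cls s = cls t"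
  unfolding cls_def using equiv_cong by (rule equiv_class_eq)

lemma self_in_cls: "t \<in> terms \<Longrightarrow> t \<in> cls t"
  unfolding cls_def using equiv_cong by (rule equiv_class_self)

lemma in_cls_iff: "s \<in> cls t \<longleftrightarrow> (t, s) \<in> lie_cong R X E"
  by (simp add: cls_def)

lemma carrier_presented: "carrier (lie_presented R X E) = cls ` terms"
  by (auto simp: lie_presented_def cls_def quotient_def)

lemma zero_presented: "\<zero>\<^bsub>lie_presented R X E\<^esub> = cls Zero"
  by (simp add: lie_presented_def cls_def)

text \<open>The operations of \<open>lie_presented\<close> are unions over all representatives. By
  the congruence rules every member of such a union is the same class, so one choice of
  representatives suffices.\<close>

lemma add_presented:
  assumes "s \<in> terms" "t \<in> terms"
  shows "cls s \<oplus>\<^bsub>lie_presented R X E\<^esub> cls t = cls (Plus s t)"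
proof -
  have "congruent2 (lie_cong R X E) (lie_cong R X E) (\<lambda>s t. cls (Plus s t))"
    by (auto simp: congruent2_def congruent_def intro!: cls_eqI lie_cong.cong_plus)
  from UN_equiv_class2[OF equiv_cong equiv_cong this assms] show ?thesis
    by (simp add: lie_presented_def cls_def)
qed

lemma smult_presented:
  assumes "r \<in> carrier R" "t \<in> terms"
  shows "r \<odot>\<^bsub>lie_presented R X E\<^esub> cls t = cls (Scale r t)"
proof -
  have "congruent (lie_cong R X E) (\<lambda>t. cls (Scale r t))"
    using assms by (auto simp: congruent_def intro!: cls_eqI lie_cong.cong_scale)
  from UN_equiv_class[OF equiv_cong this assms(2)] show ?thesis
    by (simp add: lie_presented_def cls_def)
qed

lemma bracket_presented:
  assumes "s \<in> terms" "t \<in> terms"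
  shows "\<lbrace>cls s, cls t\<rbrace>\<^bsub>lie_presented R X E\<^esub> = cls (Brack s t)"
proof -
  have "congruent2 (lie_cong R X E) (lie_cong R X E) (\<lambda>s t. cls (Brack s t))"
    by (auto simp: congruent2_def congruent_def intro!: cls_eqI lie_cong.cong_brack)
  from UN_equiv_class2[OF equiv_cong equiv_cong this assms] show ?thesis
    by (simp add: lie_presented_def cls_def)
qed

lemmas presented_simps =
  carrier_presented zero_presented add_presented smult_presented bracket_presented

lemmas cls_axioms =
  lie_cong.plus_zero[THEN cls_eqI]
  lie_cong.plus_neg[THEN cls_eqI] lie_cong.scale_add_left[THEN cls_eqI]
  lie_cong.scale_add_right[THEN cls_eqI] lie_cong.scale_mult[THEN cls_eqI]
  lie_cong.scale_one[THEN cls_eqI] lie_cong.brack_add_left[THEN cls_eqI]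
  lie_cong.brack_add_right[THEN cls_eqI] lie_cong.brack_scale_left[THEN cls_eqI]
  lie_cong.brack_scale_right[THEN cls_eqI] lie_cong.brack_alternating[THEN cls_eqI]
  lie_cong.brack_jacobi[THEN cls_eqI]

text \<open>Every axiom is a clause of \<open>lie_cong\<close> read in the quotient, with
  \<open>Neg\<close> supplying the additive inverses.\<close>

lemma lie_algebra_presented: "lie_algebra R (lie_presented R X E)"
proof -
  note [simp] = presented_simps lie_terms.intros
  have ag: "abelian_group (lie_presented R X E)"
  proof (rule abelian_groupI)
    fix x y assume "x \<in> carrier (lie_presented R X E)" "y \<in> carrier (lie_presented R X E)"
    then obtain s t where "s \<in> terms" "x = cls s" "t \<in> terms" "y = cls t" by auto
    then show "x \<oplus>\<^bsub>lie_presented R X E\<^esub> y = y \<oplus>\<^bsub>lie_presented R X E\<^esub> x"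
      by (simp add: lie_cong.plus_comm[THEN cls_eqI])
  next
    fix x assume "x \<in> carrier (lie_presented R X E)"
    then obtain t where t: "t \<in> terms" "x = cls t" by auto
    then have "cls (Neg t) \<oplus>\<^bsub>lie_presented R X E\<^esub> x = \<zero>\<^bsub>lie_presented R X E\<^esub>"
      by (simp add: cls_axioms)
    moreover have "cls (Neg t) \<in> carrier (lie_presented R X E)"
      using t by simp
    ultimately show "\<exists>y\<in>carrier (lie_presented R X E).
        y \<oplus>\<^bsub>lie_presented R X E\<^esub> x = \<zero>\<^bsub>lie_presented R X E\<^esub>"
      by blast
  qed (auto simp: cls_axioms lie_cong.plus_assoc[THEN cls_eqI])
  have "module R (lie_presented R X E)"
    by (rule moduleI[OF is_cring ag]) (auto simp: cls_axioms)
  then show ?thesis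
    by (rule lie_algebra.intro[OF _ lie_algebra_axioms.intro]) (auto simp: cls_axioms)
qed

text \<open>The record has no field for additive inverses, so this comes from their
  uniqueness.\<close>

lemma neg_presented:
  assumes "t \<in> terms"
  shows "\<ominus>\<^bsub>lie_presented R X E\<^esub> cls t = cls (Neg t)"
proof -
  note [simp] = presented_simps lie_terms.intros
  interpret T: lie_algebra R "lie_presented R X E" by (rule lie_algebra_presented)
  have "cls (Neg t) \<oplus>\<^bsub>lie_presented R X E\<^esub> cls t = \<zero>\<^bsub>lie_presented R X E\<^esub>"
    using assms by (simp add: cls_axioms)
  then show ?thesis
    using assms by (intro T.M.minus_equality) simp_all
qed

end

text \<open>Only relations between terms over \<open>X\<close> are tested, because
  \<open>lie_cong\<close> takes up only these from \<open>E\<close>.\<close>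

definition respects_relations ::
  "('r, 'u) ring_scheme \<Rightarrow> 'g set \<Rightarrow> ('r, 'g) lie_term rel \<Rightarrow>
    ('r, 'a, 'v) lie_algebra_scheme \<Rightarrow> ('g \<Rightarrow> 'a) \<Rightarrow> bool"
  where
  "respects_relations R X E A f \<longleftrightarrow> f \<in> X \<rightarrow> carrier A \<and>
    (\<forall>(s, t) \<in> E. s \<in> lie_terms R X \<longrightarrow> t \<in> lie_terms R X \<longrightarrow> lie_eval A f s = lie_eval A f t)"

lemma (in lie_algebra) lie_eval_closed:
  assumes "f \<in> X \<rightarrow> carrier L" "t \<in> lie_terms R X"
  shows "lie_eval L f t \<in> carrier L"
  using assms(2) by induction (use assms(1) in \<open>auto simp: bracket_closed\<close>)

text \<open>Soundness of the congruence: besides the relations, which \<open>f\<close> respects,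
  each clause is a law valid in every Lie algebra.\<close>

lemma (in lie_algebra) lie_eval_cong:
  assumes f: "respects_relations R X E L f" and st: "(s, t) \<in> lie_cong R X E"
  shows "lie_eval L f s = lie_eval L f t"
proof -
  have "lie_eval L f t \<in> carrier L" if "t \<in> lie_terms R X" for t
    using lie_eval_closed f that by (auto simp: respects_relations_def)
  note [simp] = this
  from st show ?thesis
  proof induction
    case (rel s t)
    then show ?case using f by (auto simp: respects_relations_def)
  next
    case (brack_jacobi s t u)
    then show ?case by (simp add: jacobi)
  qed (simp_all add: M.a_ac M.r_neg smult_l_distr smult_r_distr smult_assoc1 bracket_add_left
      bracket_add_right bracket_smult_left bracket_smult_right bracket_alternating bracket_closed)
qed

section \<open>The universal property of a presentation\<close>

context lie_presentation
begin

text \<open>Evaluation is constant on a class, so its image is a singleton and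
  \<open>the_elem\<close> returns its only element.\<close>

lemma lie_lift_cls:
  assumes "lie_algebra R A" "respects_relations R X E A f" "t \<in> terms"
  shows "lie_lift A f (cls t) = lie_eval A f t"
proof -
  have eq: "lie_eval A f t = lie_eval A f s" if "s \<in> cls t" for s
    using lie_algebra.lie_eval_cong[OF assms(1,2)] that by (simp add: in_cls_iff)
  have "lie_eval A f ` cls t = (\<lambda>_. lie_eval A f t) ` cls t"
    by (rule image_cong[OF HOL.refl eq[symmetric]])
  also have "\<dots> = {lie_eval A f t}"
    using self_in_cls[OF assms(3)] by auto
  finally show ?thesis by (simp add: lie_lift_def)
qed

lemma lie_lift_hom:
  assumes A: "lie_algebra R A" and f: "respects_relations R X E A f"
  shows "lie_lift A f \<in> lie_hom R (lie_presented R X E) A"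
proof -
  have "f \<in> X \<rightarrow> carrier A" using f by (simp add: respects_relations_def)
  then show ?thesis
    unfolding lie_hom_def
    by (auto simp: presented_simps lie_lift_cls[OF A f] lie_terms.intros
        lie_algebra.lie_eval_closed[OF A])
qed

text \<open>A morphism out of the quotient is evaluation at its own values on generators; this is
  the uniqueness half of the universal property.\<close>

lemma lie_hom_cls:
  assumes A: "lie_algebra R A" and h: "h \<in> lie_hom R (lie_presented R X E) A" and t: "t \<in> terms"
  shows "h (cls t) = lie_eval A (\<lambda>g. h (cls (Gen g))) t"
  using t
proof induction
  case zero
  show ?case
    using lie_hom_zero[OF lie_algebra_presented A h] by (simp add: zero_presented)
next
  case (neg t)
  then show ?case
    using lie_hom_neg[OF lie_algebra_presented A h, of "cls t"]
    by (simp add: neg_presented carrier_presented)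
qed (use lie_homD[OF h] in \<open>simp_all add: carrier_presented flip: add_presented smult_presented
  bracket_presented\<close>)

lemma lie_hom_eqI:
  assumes A: "lie_algebra R A"
    and "h \<in> lie_hom R (lie_presented R X E) A" "h' \<in> lie_hom R (lie_presented R X E) A"
    and gen: "\<And>g. g \<in> X \<Longrightarrow> h (cls (Gen g)) = h' (cls (Gen g))"
    and c: "c \<in> carrier (lie_presented R X E)"
  shows "h c = h' c"
proof -
  obtain t where t: "t \<in> terms" "c = cls t"
    using c by (auto simp: carrier_presented)
  have "lie_eval A (\<lambda>g. h (cls (Gen g))) t = lie_eval A (\<lambda>g. h' (cls (Gen g))) t"
    using t(1) by induction (simp_all add: gen)
  then show ?thesis
    using t assms lie_hom_cls by metis
qed

lemma deriv_closed:
  assumes "\<And>g. g \<in> X \<Longrightarrow> d g \<in> terms" "t \<in> terms"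
  shows "lie_term_deriv d t \<in> terms"
  using assms(2) by induction (auto intro: assms(1) lie_terms.intros)

end

text \<open>What the Leibniz rule makes of the Jacobi sum when primes denote derivatives. Regrouping
  yields three Jacobi sums, each with exactly one primed entry.\<close>

lemma (in lie_algebra) jacobi_derived:
  assumes "x \<in> carrier L" "y \<in> carrier L" "z \<in> carrier L"
    and "x' \<in> carrier L" "y' \<in> carrier L" "z' \<in> carrier L"
  shows "(\<lbrace>x', \<lbrace>y, z\<rbrace>\<^bsub>L\<^esub>\<rbrace>\<^bsub>L\<^esub> \<oplus>\<^bsub>L\<^esub> \<lbrace>x, \<lbrace>y', z\<rbrace>\<^bsub>L\<^esub> \<oplus>\<^bsub>L\<^esub> \<lbrace>y, z'\<rbrace>\<^bsub>L\<^esub>\<rbrace>\<^bsub>L\<^esub>)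
    \<oplus>\<^bsub>L\<^esub> (\<lbrace>y', \<lbrace>z, x\<rbrace>\<^bsub>L\<^esub>\<rbrace>\<^bsub>L\<^esub> \<oplus>\<^bsub>L\<^esub> \<lbrace>y, \<lbrace>z', x\<rbrace>\<^bsub>L\<^esub> \<oplus>\<^bsub>L\<^esub> \<lbrace>z, x'\<rbrace>\<^bsub>L\<^esub>\<rbrace>\<^bsub>L\<^esub>)
    \<oplus>\<^bsub>L\<^esub> (\<lbrace>z', \<lbrace>x, y\<rbrace>\<^bsub>L\<^esub>\<rbrace>\<^bsub>L\<^esub> \<oplus>\<^bsub>L\<^esub> \<lbrace>z, \<lbrace>x', y\<rbrace>\<^bsub>L\<^esub> \<oplus>\<^bsub>L\<^esub> \<lbrace>x, y'\<rbrace>\<^bsub>L\<^esub>\<rbrace>\<^bsub>L\<^esub>) = \<zero>\<^bsub>L\<^esub>"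
    (is "?lhs = _")
proof -
  have "?lhs =
      (\<lbrace>x', \<lbrace>y, z\<rbrace>\<^bsub>L\<^esub>\<rbrace>\<^bsub>L\<^esub> \<oplus>\<^bsub>L\<^esub> \<lbrace>y, \<lbrace>z, x'\<rbrace>\<^bsub>L\<^esub>\<rbrace>\<^bsub>L\<^esub> \<oplus>\<^bsub>L\<^esub> \<lbrace>z, \<lbrace>x', y\<rbrace>\<^bsub>L\<^esub>\<rbrace>\<^bsub>L\<^esub>)
      \<oplus>\<^bsub>L\<^esub> (\<lbrace>x, \<lbrace>y', z\<rbrace>\<^bsub>L\<^esub>\<rbrace>\<^bsub>L\<^esub> \<oplus>\<^bsub>L\<^esub> \<lbrace>y', \<lbrace>z, x\<rbrace>\<^bsub>L\<^esub>\<rbrace>\<^bsub>L\<^esub> \<oplus>\<^bsub>L\<^esub> \<lbrace>z, \<lbrace>x, y'\<rbrace>\<^bsub>L\<^esub>\<rbrace>\<^bsub>L\<^esub>)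
      \<oplus>\<^bsub>L\<^esub> (\<lbrace>x, \<lbrace>y, z'\<rbrace>\<^bsub>L\<^esub>\<rbrace>\<^bsub>L\<^esub> \<oplus>\<^bsub>L\<^esub> \<lbrace>y, \<lbrace>z', x\<rbrace>\<^bsub>L\<^esub>\<rbrace>\<^bsub>L\<^esub> \<oplus>\<^bsub>L\<^esub> \<lbrace>z', \<lbrace>x, y\<rbrace>\<^bsub>L\<^esub>\<rbrace>\<^bsub>L\<^esub>)"
    using assms by (simp add: bracket_add_right bracket_closed M.a_ac)
  then show ?thesis
    using assms by (simp add: jacobi)
qed

section \<open>Descent of derivations to presented Lie algebras\<close>

context lie_presentation
begin

text \<open>A derivation carries each Lie algebra law to a consequence of the laws, so only the
  relations in \<open>E\<close> have to be checked.\<close>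

lemma deriv_cong:
  assumes d: "\<And>g. g \<in> X \<Longrightarrow> d g \<in> terms"
    and E: "\<And>s t. \<lbrakk>(s, t) \<in> E; s \<in> terms; t \<in> terms\<rbrakk> \<Longrightarrow>
      cls (lie_term_deriv d s) = cls (lie_term_deriv d t)"
    and st: "(s, t) \<in> lie_cong R X E"
  shows "cls (lie_term_deriv d s) = cls (lie_term_deriv d t)"
proof -
  interpret T: lie_algebra R "lie_presented R X E" by (rule lie_algebra_presented)
  have cls: "cls t \<in> carrier (lie_presented R X E)" if "t \<in> terms" for t
    using that by (simp add: carrier_presented)
  \<comment> \<open>Reversing the rules pushes \<open>cls\<close> through the term constructors, so
    each case becomes an identity in the quotient Lie algebra.\<close>
  note [simp] = deriv_closed[OF d] lie_terms.intros cls T.bracket_closed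
    add_presented[symmetric] smult_presented[symmetric] bracket_presented[symmetric]
    neg_presented[symmetric] zero_presented[symmetric]
  from st show ?thesis
  proof induction
    case (rel s t)
    then show ?case by (rule E)
  next
    case (cong_neg s t)
    then show ?case by (simp add: cong_terms)
  next
    case (cong_plus s s' t t')
    then show ?case by (simp add: cong_terms)
  next
    case (cong_scale r s t)
    then show ?case by (simp add: cong_terms)
  next
    case (cong_brack s s' t t')
    \<comment> \<open>The Leibniz rule also leaves undifferentiated factors, whose classes have to
      agree as well.\<close>
    then have "cls s = cls s'" "cls t = cls t'" by (simp_all add: cls_eqI)
    with cong_brack show ?case by (simp add: cong_terms)
  next
    case (plus_comm s t)
    then show ?case by (simp add: T.M.a_comm)
  next
    case (brack_alternating t)
    then show ?case
      \<comment> \<open>The derivative of the bracket of \<open>t\<close> with itself is a sum of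
        two brackets in opposite order.\<close>
      using T.bracket_antisym[of "cls t" "cls (lie_term_deriv d t)"] by (simp add: T.M.l_neg T.M.r_neg)
  next
    case (brack_jacobi s t u)
    then show ?case by (simp add: T.jacobi_derived)
  qed (simp_all add: T.M.a_ac T.M.r_neg T.smult_l_distr T.smult_r_distr T.smult_assoc1
      T.bracket_add_left T.bracket_add_right T.bracket_smult_left T.bracket_smult_right)
qed

end


section \<open>The tensor product\<close>

context lie_crossed_module
begin

lemma bd_closed: "m \<in> carrier M \<Longrightarrow> bd m \<in> carrier L"
  using bd_hom by (rule lie_homD)

text \<open>Equivariance turns the boundary of \<open>act l m\<close> into a bracket in
  \<open>L\<close>, and an action sends brackets to commutators.\<close>

lemma act_bd_act:
  assumes "lie_action R L A aA" "l \<in> carrier L" "m \<in> carrier M" "x \<in> carrier A"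
  shows "aA (bd (act l m)) x = aA l (aA (bd m) x) \<ominus>\<^bsub>A\<^esub> aA (bd m) (aA l x)"
  using assms by (simp add: bd_equivariant lie_action.act_bracket_left[OF assms(1)] bd_closed)

end

locale crossed_pair =
  MX: lie_crossed_module R L M aM mu + NX: lie_crossed_module R L N aN nu
  for R :: "('r, 'u) ring_scheme"
    and L :: "('r, 'l, 'v) lie_algebra_scheme"
    and M :: "('r, 'm, 'w) lie_algebra_scheme"
    and N :: "('r, 'n, 'x) lie_algebra_scheme"
    and aM aN mu nu
begin

sublocale TP: lie_presentation R "carrier M \<times> carrier N" "tensor_relations R M aM mu N aN nu"
  by unfold_locales

abbreviation T where "T \<equiv> lie_tensor R M aM mu N aN nu"

abbreviation tensor (infixl "\<otimes>" 70) where "m \<otimes> n \<equiv> tensor_elt R M aM mu N aN nu m n"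

sublocale T: lie_algebra R T
  unfolding lie_tensor_def by (rule TP.lie_algebra_presented)

lemma tensor_elt_cls: "m \<otimes> n = TP.cls (Gen (m, n))"
  by (simp add: tensor_elt_def TP.cls_def)

end

context crossed_pair
begin

lemmas actions_closed [simp] = MX.act_closed NX.act_closed MX.bd_closed NX.bd_closed

lemma aM_mu: "\<lbrakk>m \<in> carrier M; m' \<in> carrier M\<rbrakk> \<Longrightarrow> aM (mu m) m' = \<lbrace>m, m'\<rbrace>\<^bsub>M\<^esub>"
  by (rule MX.peiffer)

lemma aN_mu_act:
  "\<lbrakk>l \<in> carrier L; m \<in> carrier M; n \<in> carrier N\<rbrakk> \<Longrightarrow>
    aN (mu (aM l m)) n = aN l (aN (mu m) n) \<ominus>\<^bsub>N\<^esub> aN (mu m) (aN l n)"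
  by (rule MX.act_bd_act[OF NX.lie_action_axioms])

lemma aM_nu_act:
  "\<lbrakk>l \<in> carrier L; n \<in> carrier N; m \<in> carrier M\<rbrakk> \<Longrightarrow>
    aM (nu (aN l n)) m = aM l (aM (nu n) m) \<ominus>\<^bsub>M\<^esub> aM (nu n) (aM l m)"
  by (rule NX.act_bd_act[OF MX.lie_action_axioms])

lemma aM_nu_bracket:
  "\<lbrakk>n \<in> carrier N; n' \<in> carrier N; m \<in> carrier M\<rbrakk> \<Longrightarrow>
    aM (nu \<lbrace>n, n'\<rbrace>\<^bsub>N\<^esub>) m = aM (nu n) (aM (nu n') m) \<ominus>\<^bsub>M\<^esub> aM (nu n') (aM (nu n) m)"
  using lie_homD(4)[OF NX.bd_hom] by (simp add: MX.act_bracket_left)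

lemma aN_mu_bracket:
  "\<lbrakk>m \<in> carrier M; m' \<in> carrier M; n \<in> carrier N\<rbrakk> \<Longrightarrow>
    aN (mu \<lbrace>m, m'\<rbrace>\<^bsub>M\<^esub>) n = aN (mu m) (aN (mu m') n) \<ominus>\<^bsub>N\<^esub> aN (mu m') (aN (mu m) n)"
  using lie_homD(4)[OF MX.bd_hom] by (simp add: NX.act_bracket_left)

end

text \<open>The assumptions copy \<open>tensor_relations\<close> clause by clause, read in
  \<open>A\<close>; this makes \<open>lie_lift A k\<close> a morphism on the tensor product.\<close>

locale lie_pairing = crossed_pair R L M N aM aN mu nu + A: lie_algebra R A
  for R :: "('r, 'u) ring_scheme"
    and L :: "('r, 'l, 'v) lie_algebra_scheme"
    and M :: "('r, 'm, 'w) lie_algebra_scheme"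
    and N :: "('r, 'n, 'x) lie_algebra_scheme"
    and aM aN mu nu
    and A :: "('r, 'a, 'y) lie_algebra_scheme" +
  fixes k :: "'m \<times> 'n \<Rightarrow> 'a"
  assumes closed: "\<lbrakk>m \<in> carrier M; n \<in> carrier N\<rbrakk> \<Longrightarrow> k (m, n) \<in> carrier A"
    and add_left:
      "\<lbrakk>m \<in> carrier M; m' \<in> carrier M; n \<in> carrier N\<rbrakk> \<Longrightarrow>
        k (m \<oplus>\<^bsub>M\<^esub> m', n) = k (m, n) \<oplus>\<^bsub>A\<^esub> k (m', n)"
    and add_right:
      "\<lbrakk>m \<in> carrier M; n \<in> carrier N; n' \<in> carrier N\<rbrakk> \<Longrightarrow>
        k (m, n \<oplus>\<^bsub>N\<^esub> n') = k (m, n) \<oplus>\<^bsub>A\<^esub> k (m, n')"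
    and smult_left:
      "\<lbrakk>r \<in> carrier R; m \<in> carrier M; n \<in> carrier N\<rbrakk> \<Longrightarrow> k (r \<odot>\<^bsub>M\<^esub> m, n) = r \<odot>\<^bsub>A\<^esub> k (m, n)"
    and smult_right:
      "\<lbrakk>r \<in> carrier R; m \<in> carrier M; n \<in> carrier N\<rbrakk> \<Longrightarrow> k (m, r \<odot>\<^bsub>N\<^esub> n) = r \<odot>\<^bsub>A\<^esub> k (m, n)"
    and bracket_left:
      "\<lbrakk>m \<in> carrier M; m' \<in> carrier M; n \<in> carrier N\<rbrakk> \<Longrightarrow>
        k (\<lbrace>m, m'\<rbrace>\<^bsub>M\<^esub>, n) = k (m, aN (mu m') n) \<ominus>\<^bsub>A\<^esub> k (m', aN (mu m) n)"
    and bracket_right: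
      "\<lbrakk>m \<in> carrier M; n \<in> carrier N; n' \<in> carrier N\<rbrakk> \<Longrightarrow>
        k (m, \<lbrace>n, n'\<rbrace>\<^bsub>N\<^esub>) = k (aM (nu n') m, n) \<ominus>\<^bsub>A\<^esub> k (aM (nu n) m, n')"
    and bracket_gen:
      "\<lbrakk>m \<in> carrier M; n \<in> carrier N; m' \<in> carrier M; n' \<in> carrier N\<rbrakk> \<Longrightarrow>
        \<lbrace>k (m, n), k (m', n')\<rbrace>\<^bsub>A\<^esub> = \<ominus>\<^bsub>A\<^esub> k (aM (nu n) m, aN (mu m') n')"
begin

lemma neg_left: "\<lbrakk>m \<in> carrier M; n \<in> carrier N\<rbrakk> \<Longrightarrow> k (\<ominus>\<^bsub>M\<^esub> m, n) = \<ominus>\<^bsub>A\<^esub> k (m, n)"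
proof -
  assume [simp]: "m \<in> carrier M" "n \<in> carrier N"
  have "k (\<zero>\<^bsub>M\<^esub>, n) = \<zero>\<^bsub>A\<^esub>"
    using add_left[of "\<zero>\<^bsub>M\<^esub>" "\<zero>\<^bsub>M\<^esub>" n] by (simp add: closed A.M.add.r_cancel_one')
  then show ?thesis
    using add_left[of "\<ominus>\<^bsub>M\<^esub> m" m n] by (simp add: closed MX.M.M.l_neg A.M.minus_equality)
qed

lemma diff_left:
  "\<lbrakk>m \<in> carrier M; m' \<in> carrier M; n \<in> carrier N\<rbrakk> \<Longrightarrow>
    k (m \<ominus>\<^bsub>M\<^esub> m', n) = k (m, n) \<ominus>\<^bsub>A\<^esub> k (m', n)"
  by (simp add: a_minus_def add_left neg_left)

lemma neg_right: "\<lbrakk>m \<in> carrier M; n \<in> carrier N\<rbrakk> \<Longrightarrow> k (m, \<ominus>\<^bsub>N\<^esub> n) = \<ominus>\<^bsub>A\<^esub> k (m, n)"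
proof -
  assume [simp]: "m \<in> carrier M" "n \<in> carrier N"
  have "k (m, \<zero>\<^bsub>N\<^esub>) = \<zero>\<^bsub>A\<^esub>"
    using add_right[of m "\<zero>\<^bsub>N\<^esub>" "\<zero>\<^bsub>N\<^esub>"] by (simp add: closed A.M.add.r_cancel_one')
  then show ?thesis
    using add_right[of m "\<ominus>\<^bsub>N\<^esub> n" n] by (simp add: closed NX.M.M.l_neg A.M.minus_equality)
qed

lemma diff_right:
  "\<lbrakk>m \<in> carrier M; n \<in> carrier N; n' \<in> carrier N\<rbrakk> \<Longrightarrow>
    k (m, n \<ominus>\<^bsub>N\<^esub> n') = k (m, n) \<ominus>\<^bsub>A\<^esub> k (m, n')"
  by (simp add: a_minus_def add_right neg_right)

lemma respects_relations:
  "respects_relations R (carrier M \<times> carrier N) (tensor_relations R M aM mu N aN nu) A k"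
proof -
  have "lie_eval A k s = lie_eval A k t" if "(s, t) \<in> tensor_relations R M aM mu N aN nu" for s t
    using that by cases (simp_all add: add_left add_right smult_left smult_right bracket_left
      bracket_right bracket_gen a_minus_def)
  then show ?thesis
    unfolding respects_relations_def by (blast intro: closed)
qed

lemma lift_hom: "lie_lift A k \<in> lie_hom R T A"
  unfolding lie_tensor_def by (rule TP.lie_lift_hom[OF A.lie_algebra_axioms respects_relations])

lemma lift_cls: "t \<in> TP.terms \<Longrightarrow> lie_lift A k (TP.cls t) = lie_eval A k t"
  by (rule TP.lie_lift_cls[OF A.lie_algebra_axioms respects_relations])

lemma lift_tensor_elt:
  "\<lbrakk>m \<in> carrier M; n \<in> carrier N\<rbrakk> \<Longrightarrow> lie_lift A k (m \<otimes> n) = k (m, n)"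
  by (simp add: tensor_elt_cls lift_cls lie_terms.gen)

text \<open>The relation \<open>bracket_left\<close> differentiated by \<open>l\<close>, as needed
  for the action of \<open>L\<close> on the tensor product. After expanding the actions of
  \<open>aM l m\<close> and \<open>aM l m'\<close> as commutators, the terms containing
  \<open>aN l n\<close> cancel.\<close>

lemma derived_bracket_left:
  assumes [simp]: "l \<in> carrier L" "m \<in> carrier M" "m' \<in> carrier M" "n \<in> carrier N"
  shows "k (aM l \<lbrace>m, m'\<rbrace>\<^bsub>M\<^esub>, n) \<oplus>\<^bsub>A\<^esub> k (\<lbrace>m, m'\<rbrace>\<^bsub>M\<^esub>, aN l n) =
    (k (aM l m, aN (mu m') n) \<oplus>\<^bsub>A\<^esub> k (m, aN l (aN (mu m') n)))
    \<ominus>\<^bsub>A\<^esub> (k (aM l m', aN (mu m) n) \<oplus>\<^bsub>A\<^esub> k (m', aN l (aN (mu m) n)))"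
  by (simp add: MX.act_bracket_right add_left bracket_left aN_mu_act diff_right closed
      MX.M.bracket_closed A.M.diff_simps A.M.a_ac)

lemma derived_bracket_right:
  assumes [simp]: "l \<in> carrier L" "m \<in> carrier M" "n \<in> carrier N" "n' \<in> carrier N"
  shows "k (aM l m, \<lbrace>n, n'\<rbrace>\<^bsub>N\<^esub>) \<oplus>\<^bsub>A\<^esub> k (m, aN l \<lbrace>n, n'\<rbrace>\<^bsub>N\<^esub>) =
    (k (aM l (aM (nu n') m), n) \<oplus>\<^bsub>A\<^esub> k (aM (nu n') m, aN l n))
    \<ominus>\<^bsub>A\<^esub> (k (aM l (aM (nu n) m), n') \<oplus>\<^bsub>A\<^esub> k (aM (nu n) m, aN l n'))"
  by (simp add: NX.act_bracket_right add_right bracket_right aM_nu_act diff_left closed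
      NX.M.bracket_closed A.M.diff_simps A.M.a_ac)

text \<open>The relation \<open>bracket_gen\<close> differentiated by \<open>l\<close>. In each
  argument, the commutator expansion of one summand cancels the term in which \<open>l\<close> acts
  first.\<close>

lemma derived_bracket_gen:
  assumes [simp]: "l \<in> carrier L" "m \<in> carrier M" "n \<in> carrier N" "m' \<in> carrier M" "n' \<in> carrier N"
  shows "\<lbrace>k (aM l m, n) \<oplus>\<^bsub>A\<^esub> k (m, aN l n), k (m', n')\<rbrace>\<^bsub>A\<^esub>
      \<oplus>\<^bsub>A\<^esub> \<lbrace>k (m, n), k (aM l m', n') \<oplus>\<^bsub>A\<^esub> k (m', aN l n')\<rbrace>\<^bsub>A\<^esub> =
    \<ominus>\<^bsub>A\<^esub> (k (aM l (aM (nu n) m), aN (mu m') n') \<oplus>\<^bsub>A\<^esub> k (aM (nu n) m, aN l (aN (mu m') n')))"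
  by (simp add: A.bracket_add_left A.bracket_add_right bracket_gen aM_nu_act aN_mu_act diff_left
      diff_right closed A.M.minus_add A.M.diff_simps A.M.a_ac)

end

section \<open>The canonical pairings: the universal one and the two projections\<close>

context crossed_pair
begin

text \<open>The universal pairing: its clauses hold because the congruence contains the defining
  relations.\<close>

lemma tensor_pairing: "lie_pairing R L M N aM aN mu nu T (\<lambda>(m, n). m \<otimes> n)"
proof -
  have rel: "TP.cls s = TP.cls t"
    if "(s, t) \<in> tensor_relations R M aM mu N aN nu" "s \<in> TP.terms" "t \<in> TP.terms" for s t
    using that by (intro TP.cls_eqI lie_cong.rel)
  note [simp] = lie_terms.intros MX.M.bracket_closed NX.M.bracket_closed
    TP.presented_simps TP.neg_presented tensor_elt_cls lie_tensor_def a_minus_def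
    tensor_relations.intros[THEN rel]
  show ?thesis
    by unfold_locales simp_all
qed

text \<open>This makes \<open>tensor_proj1\<close> a well-defined morphism. The bracket clauses
  follow from the Leibniz rule, the equivariance of \<open>nu\<close> and the Peiffer identity in
  \<open>M\<close>.\<close>

lemma proj1_pairing: "lie_pairing R L M N aM aN mu nu M (\<lambda>(m, n). \<ominus>\<^bsub>M\<^esub> aM (nu n) m)"
proof unfold_locales
  note [simp] = MX.M.bracket_closed NX.M.bracket_closed
  fix m n assume [simp]: "m \<in> carrier M" "n \<in> carrier N"
  show "(case (m, n) of (m, n) \<Rightarrow> \<ominus>\<^bsub>M\<^esub> aM (nu n) m) \<in> carrier M"
    by simp
  show "(case (r \<odot>\<^bsub>M\<^esub> m, n) of (m, n) \<Rightarrow> \<ominus>\<^bsub>M\<^esub> aM (nu n) m) =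
      r \<odot>\<^bsub>M\<^esub> (case (m, n) of (m, n) \<Rightarrow> \<ominus>\<^bsub>M\<^esub> aM (nu n) m)" if "r \<in> carrier R" for r
    using that by (simp add: MX.act_smult_right MX.M.smult_r_minus)
  show "(case (m, r \<odot>\<^bsub>N\<^esub> n) of (m, n) \<Rightarrow> \<ominus>\<^bsub>M\<^esub> aM (nu n) m) =
      r \<odot>\<^bsub>M\<^esub> (case (m, n) of (m, n) \<Rightarrow> \<ominus>\<^bsub>M\<^esub> aM (nu n) m)" if "r \<in> carrier R" for r
    using that lie_homD(3)[OF NX.bd_hom] by (simp add: MX.act_smult_left MX.M.smult_r_minus)
  fix m' assume [simp]: "m' \<in> carrier M"
  show "(case (m \<oplus>\<^bsub>M\<^esub> m', n) of (m, n) \<Rightarrow> \<ominus>\<^bsub>M\<^esub> aM (nu n) m) =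
      (case (m, n) of (m, n) \<Rightarrow> \<ominus>\<^bsub>M\<^esub> aM (nu n) m) \<oplus>\<^bsub>M\<^esub>
      (case (m', n) of (m, n) \<Rightarrow> \<ominus>\<^bsub>M\<^esub> aM (nu n) m)"
    by (simp add: MX.act_add_right MX.M.M.minus_add)
  show "(case (\<lbrace>m, m'\<rbrace>\<^bsub>M\<^esub>, n) of (m, n) \<Rightarrow> \<ominus>\<^bsub>M\<^esub> aM (nu n) m) =
      (case (m, aN (mu m') n) of (m, n) \<Rightarrow> \<ominus>\<^bsub>M\<^esub> aM (nu n) m) \<ominus>\<^bsub>M\<^esub>
      (case (m', aN (mu m) n) of (m, n) \<Rightarrow> \<ominus>\<^bsub>M\<^esub> aM (nu n) m)"
    \<comment> \<open>Expansion leaves the bracket of \<open>m\<close> and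
      \<open>aM (nu n) m'\<close> in opposite orders on the two sides.\<close>
    using MX.M.bracket_antisym[of m "aM (nu n) m'"]
    by (simp add: MX.act_bracket_right aM_nu_act aM_mu MX.M.M.diff_simps MX.M.M.a_ac)
next
  note [simp] = MX.M.bracket_closed NX.M.bracket_closed
  fix m n n' assume [simp]: "m \<in> carrier M" "n \<in> carrier N" "n' \<in> carrier N"
  show "(case (m, n \<oplus>\<^bsub>N\<^esub> n') of (m, n) \<Rightarrow> \<ominus>\<^bsub>M\<^esub> aM (nu n) m) =
      (case (m, n) of (m, n) \<Rightarrow> \<ominus>\<^bsub>M\<^esub> aM (nu n) m) \<oplus>\<^bsub>M\<^esub>
      (case (m, n') of (m, n) \<Rightarrow> \<ominus>\<^bsub>M\<^esub> aM (nu n) m)"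
    using lie_homD(2)[OF NX.bd_hom] by (simp add: MX.act_add_left MX.M.M.minus_add)
  show "(case (m, \<lbrace>n, n'\<rbrace>\<^bsub>N\<^esub>) of (m, n) \<Rightarrow> \<ominus>\<^bsub>M\<^esub> aM (nu n) m) =
      (case (aM (nu n') m, n) of (m, n) \<Rightarrow> \<ominus>\<^bsub>M\<^esub> aM (nu n) m) \<ominus>\<^bsub>M\<^esub>
      (case (aM (nu n) m, n') of (m, n) \<Rightarrow> \<ominus>\<^bsub>M\<^esub> aM (nu n) m)"
    by (simp add: aM_nu_bracket MX.M.M.diff_simps MX.M.M.a_ac)
  fix m' assume [simp]: "m' \<in> carrier M"
  \<comment> \<open>The commutator form of the action of \<open>aN (mu m') n'\<close> on
    \<open>M\<close> reduces, by the Leibniz rule, to minus the bracket with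
    \<open>aM (nu n') m'\<close>. Antisymmetry removes the sign.\<close>
  have "\<lbrace>aM (nu n) m, aM (nu n') m'\<rbrace>\<^bsub>M\<^esub> =
      aM (nu (aN (mu m') n')) (aM (nu n) m)"
    using MX.M.bracket_antisym[of "aM (nu n') m'" "aM (nu n) m"]
    by (simp add: aM_nu_act aM_mu MX.act_bracket_right MX.M.M.diff_simps MX.M.M.a_ac)
  then show "\<lbrace>case (m, n) of (m, n) \<Rightarrow> \<ominus>\<^bsub>M\<^esub> aM (nu n) m,
      case (m', n') of (m, n) \<Rightarrow> \<ominus>\<^bsub>M\<^esub> aM (nu n) m\<rbrace>\<^bsub>M\<^esub> =
      \<ominus>\<^bsub>M\<^esub> (case (aM (nu n) m, aN (mu m') n') of (m, n) \<Rightarrow> \<ominus>\<^bsub>M\<^esub> aM (nu n) m)"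
    by (simp add: MX.M.bracket_neg_left MX.M.bracket_neg_right)
qed

lemma proj2_pairing: "lie_pairing R L M N aM aN mu nu N (\<lambda>(m, n). aN (mu m) n)"
proof unfold_locales
  note [simp] = MX.M.bracket_closed NX.M.bracket_closed
  fix m n assume [simp]: "m \<in> carrier M" "n \<in> carrier N"
  show "(case (m, n) of (m, n) \<Rightarrow> aN (mu m) n) \<in> carrier N"
    by simp
  show "(case (r \<odot>\<^bsub>M\<^esub> m, n) of (m, n) \<Rightarrow> aN (mu m) n) =
      r \<odot>\<^bsub>N\<^esub> (case (m, n) of (m, n) \<Rightarrow> aN (mu m) n)" if "r \<in> carrier R" for r
    using that lie_homD(3)[OF MX.bd_hom] by (simp add: NX.act_smult_left)
  show "(case (m, r \<odot>\<^bsub>N\<^esub> n) of (m, n) \<Rightarrow> aN (mu m) n) =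
      r \<odot>\<^bsub>N\<^esub> (case (m, n) of (m, n) \<Rightarrow> aN (mu m) n)" if "r \<in> carrier R" for r
    using that by (simp add: NX.act_smult_right)
  fix m' assume [simp]: "m' \<in> carrier M"
  show "(case (m \<oplus>\<^bsub>M\<^esub> m', n) of (m, n) \<Rightarrow> aN (mu m) n) =
      (case (m, n) of (m, n) \<Rightarrow> aN (mu m) n) \<oplus>\<^bsub>N\<^esub> (case (m', n) of (m, n) \<Rightarrow> aN (mu m) n)"
    using lie_homD(2)[OF MX.bd_hom] by (simp add: NX.act_add_left)
  show "(case (\<lbrace>m, m'\<rbrace>\<^bsub>M\<^esub>, n) of (m, n) \<Rightarrow> aN (mu m) n) =
      (case (m, aN (mu m') n) of (m, n) \<Rightarrow> aN (mu m) n) \<ominus>\<^bsub>N\<^esub>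
      (case (m', aN (mu m) n) of (m, n) \<Rightarrow> aN (mu m) n)"
    by (simp add: aN_mu_bracket)
next
  note [simp] = MX.M.bracket_closed NX.M.bracket_closed
  fix m n n' assume [simp]: "m \<in> carrier M" "n \<in> carrier N" "n' \<in> carrier N"
  show "(case (m, n \<oplus>\<^bsub>N\<^esub> n') of (m, n) \<Rightarrow> aN (mu m) n) =
      (case (m, n) of (m, n) \<Rightarrow> aN (mu m) n) \<oplus>\<^bsub>N\<^esub> (case (m, n') of (m, n) \<Rightarrow> aN (mu m) n)"
    by (simp add: NX.act_add_right)
  show "(case (m, \<lbrace>n, n'\<rbrace>\<^bsub>N\<^esub>) of (m, n) \<Rightarrow> aN (mu m) n) =
      (case (aM (nu n') m, n) of (m, n) \<Rightarrow> aN (mu m) n) \<ominus>\<^bsub>N\<^esub>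
      (case (aM (nu n) m, n') of (m, n) \<Rightarrow> aN (mu m) n)"
    using NX.M.bracket_antisym[of n "aN (mu m) n'"]
    by (simp add: NX.act_bracket_right aN_mu_act NX.peiffer NX.M.M.diff_simps NX.M.M.a_ac)
  fix m' assume [simp]: "m' \<in> carrier M"
  show "\<lbrace>case (m, n) of (m, n) \<Rightarrow> aN (mu m) n, case (m', n') of (m, n) \<Rightarrow> aN (mu m) n\<rbrace>\<^bsub>N\<^esub> =
      \<ominus>\<^bsub>N\<^esub> (case (aM (nu n) m, aN (mu m') n') of (m, n) \<Rightarrow> aN (mu m) n)"
    \<comment> \<open>The element \<open>aM (nu n) m\<close> acts on \<open>N\<close> as the
      commutator of the bracket with \<open>n\<close> and the derivation \<open>aN (mu m)\<close>,
      that is, as minus the bracket with \<open>aN (mu m) n\<close>.\<close>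
    by (simp add: NX.act_bracket_right aN_mu_act NX.peiffer NX.M.M.diff_simps NX.M.M.a_ac)
qed

end

text \<open>Since \<open>f\<close> and \<open>g\<close> are equivariant and compatible with the
  boundaries, they preserve the mutual actions, and so each clause pulls back along them.\<close>

lemma (in lie_pairing) lie_pairing_comp:
  assumes "crossed_pair R L M' N' aM' aN' mu' nu'"
    and f: "f \<in> lie_hom R M' M" "lie_equivariant L M' aM' aM f"
      "\<And>x. x \<in> carrier M' \<Longrightarrow> mu (f x) = mu' x"
    and g: "g \<in> lie_hom R N' N" "lie_equivariant L N' aN' aN g"
      "\<And>y. y \<in> carrier N' \<Longrightarrow> nu (g y) = nu' y"
  shows "lie_pairing R L M' N' aM' aN' mu' nu' A (\<lambda>(x, y). k (f x, g y))"
proof -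
  interpret D: crossed_pair R L M' N' aM' aN' mu' nu' by fact
  have "f (aM' l x) = aM l (f x)" if "l \<in> carrier L" "x \<in> carrier M'" for l x
    using f that by (simp add: lie_equivariant_def)
  moreover have "g (aN' l y) = aN l (g y)" if "l \<in> carrier L" "y \<in> carrier N'" for l y
    using g that by (simp add: lie_equivariant_def)
  ultimately show ?thesis
    by unfold_locales (simp_all add: closed add_left add_right smult_left smult_right bracket_left
      bracket_right bracket_gen f(3) g(3) lie_homD[OF f(1)] lie_homD[OF g(1)])
qed

lemma lie_hom_comp:
  "\<lbrakk>f \<in> lie_hom R A B; g \<in> lie_hom R B C\<rbrakk> \<Longrightarrow> (\<lambda>x. g (f x)) \<in> lie_hom R A C"
  unfolding lie_hom_def by (auto simp: Pi_iff)

lemma id_in_lie_hom: "id \<in> lie_hom R A A"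
  by (simp add: lie_hom_def)

lemma lie_equivariant_id: "lie_equivariant L A act act id"
  by (simp add: lie_equivariant_def)

section \<open>Morphisms out of the tensor product and the action of \<open>L\<close> on it\<close>

context crossed_pair
begin

lemma carrier_tensor: "carrier T = TP.cls ` TP.terms"
  by (simp add: lie_tensor_def TP.carrier_presented)

lemma tensor_elt_closed: "\<lbrakk>m \<in> carrier M; n \<in> carrier N\<rbrakk> \<Longrightarrow> m \<otimes> n \<in> carrier T"
  by (simp add: carrier_tensor tensor_elt_cls lie_terms.gen)

lemma tensor_hom_eqI:
  assumes "lie_algebra R A" "h \<in> lie_hom R T A" "h' \<in> lie_hom R T A"
    and "\<And>m n. \<lbrakk>m \<in> carrier M; n \<in> carrier N\<rbrakk> \<Longrightarrow> h (m \<otimes> n) = h' (m \<otimes> n)"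
    and "c \<in> carrier T"
  shows "h c = h' c"
  using TP.lie_hom_eqI[OF assms(1), folded lie_tensor_def, OF assms(2,3)] assms(4,5)
  by (auto simp: tensor_elt_cls)

definition tensor_deriv where
  "tensor_deriv l = lie_term_deriv (\<lambda>(m, n). Plus (Gen (aM l m, n)) (Gen (m, aN l n)))"

lemma tensor_deriv_closed:
  assumes "l \<in> carrier L" "t \<in> TP.terms"
  shows "tensor_deriv l t \<in> TP.terms"
  unfolding tensor_deriv_def using assms(1)
  by (intro TP.deriv_closed assms(2)) (auto intro!: lie_terms.intros)

text \<open>Makes \<open>tensor_act\<close> independent of representatives. For the three bracket
  relations this is \<open>derived_bracket_left\<close>, \<open>derived_bracket_right\<close> and
  \<open>derived_bracket_gen\<close> for the universal pairing; the others use linearity of the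
  actions.\<close>

lemma tensor_deriv_cong:
  assumes l: "l \<in> carrier L" and st: "(s, t) \<in> tensor_cong R M aM mu N aN nu"
  shows "TP.cls (tensor_deriv l s) = TP.cls (tensor_deriv l t)"
  unfolding tensor_deriv_def
proof (rule TP.deriv_cong[OF _ _ st])
  interpret K: lie_pairing R L M N aM aN mu nu T "\<lambda>(m, n). m \<otimes> n"
    by (rule tensor_pairing)
  let ?d = "\<lambda>(m, n). Plus (Gen (aM l m, n)) (Gen (m, aN l n))"
  show "?d g \<in> TP.terms" if "g \<in> carrier M \<times> carrier N" for g
    using that l by (auto intro!: lie_terms.intros)
  fix s t assume "(s, t) \<in> tensor_relations R M aM mu N aN nu"
  have gen[simp]: "Gen (m, n) \<in> TP.terms" if "m \<in> carrier M" "n \<in> carrier N" for m n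
    using that by (auto intro: lie_terms.gen)
  note [simp] = l MX.M.bracket_closed NX.M.bracket_closed tensor_elt_closed
    lie_terms.plus lie_terms.neg lie_terms.scale lie_terms.brack
    tensor_elt_cls[symmetric] TP.add_presented[folded lie_tensor_def, symmetric]
    TP.smult_presented[folded lie_tensor_def, symmetric]
    TP.bracket_presented[folded lie_tensor_def, symmetric]
    TP.neg_presented[folded lie_tensor_def, symmetric]
  from \<open>(s, t) \<in> _\<close> show "TP.cls (lie_term_deriv ?d s) = TP.cls (lie_term_deriv ?d t)"
  proof cases
    case (add_left m m' n)
    then show ?thesis
      using K.add_left by (simp add: MX.act_add_right T.M.a_ac)
  next
    case (add_right m n n')
    then show ?thesis
      using K.add_right by (simp add: NX.act_add_right T.M.a_ac)
  next
    case (smult_left r m n)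
    then show ?thesis
      using K.smult_left by (simp add: MX.act_smult_right T.smult_r_distr)
  next
    case (smult_right r m n)
    then show ?thesis
      using K.smult_right by (simp add: NX.act_smult_right T.smult_r_distr)
  next
    case (bracket_left m m' n)
    then show ?thesis
      using K.derived_bracket_left[of l m m' n] by (simp add: a_minus_def)
  next
    case (bracket_right m n n')
    then show ?thesis
      using K.derived_bracket_right[of l m n n'] by (simp add: a_minus_def)
  next
    case (bracket_gen m n m' n')
    then show ?thesis
      using K.derived_bracket_gen[of l m n m' n'] by simp
  qed
qed

lemma tensor_act_cls:
  assumes "l \<in> carrier L" "t \<in> TP.terms"
  shows "tensor_act R M aM mu N aN nu l (TP.cls t) = TP.cls (tensor_deriv l t)"
proof -
  have "congruent (tensor_cong R M aM mu N aN nu) (\<lambda>t. TP.cls (tensor_deriv l t))"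
    using tensor_deriv_cong[OF assms(1)] by (simp add: congruentI)
  from UN_equiv_class[OF TP.equiv_cong this assms(2)] show ?thesis
    by (simp add: tensor_act_def TP.cls_def tensor_deriv_def)
qed

lemma tensor_act_closed:
  "\<lbrakk>l \<in> carrier L; c \<in> carrier T\<rbrakk> \<Longrightarrow> tensor_act R M aM mu N aN nu l c \<in> carrier T"
  by (auto simp: carrier_tensor tensor_act_cls tensor_deriv_closed)

lemma tensor_act_tensor_elt:
  assumes "l \<in> carrier L" "m \<in> carrier M" "n \<in> carrier N"
  shows "tensor_act R M aM mu N aN nu l (m \<otimes> n) = aM l m \<otimes> n \<oplus>\<^bsub>T\<^esub> m \<otimes> aN l n"
  using assms
  by (simp add: tensor_elt_cls tensor_act_cls lie_terms.gen tensor_deriv_def lie_tensor_def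
      TP.add_presented)

text \<open>The universal pairing pulled back along \<open>f\<close> and \<open>g\<close>; its lift
  is \<open>tensor_map\<close>, which is thereby a well-defined morphism.\<close>

lemma tensor_map_pairing:
  assumes "crossed_pair R L M' N' aM' aN' mu' nu'"
    and "f \<in> lie_hom R M' M" "lie_equivariant L M' aM' aM f"
      "\<And>x. x \<in> carrier M' \<Longrightarrow> mu (f x) = mu' x"
    and "g \<in> lie_hom R N' N" "lie_equivariant L N' aN' aN g"
      "\<And>y. y \<in> carrier N' \<Longrightarrow> nu (g y) = nu' y"
  shows "lie_pairing R L M' N' aM' aN' mu' nu' T (\<lambda>(x, y). f x \<otimes> g y)"
  using lie_pairing.lie_pairing_comp[OF tensor_pairing assms] by simp

end

text \<open>The derivation on terms and the action \<open>aA\<close> obey the same Leibniz rule, so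
  the identity spreads from generators to all terms by induction.\<close>

lemma (in lie_pairing) lift_equivariant:
  assumes act: "lie_action R L A aA"
    and k: "\<And>l m n. \<lbrakk>l \<in> carrier L; m \<in> carrier M; n \<in> carrier N\<rbrakk> \<Longrightarrow>
      aA l (k (m, n)) = k (aM l m, n) \<oplus>\<^bsub>A\<^esub> k (m, aN l n)"
  shows "lie_equivariant L T (tensor_act R M aM mu N aN nu) aA (lie_lift A k)"
  unfolding lie_equivariant_def
proof (intro ballI)
  interpret A': lie_action R L A aA by fact
  fix l c assume l: "l \<in> carrier L" and "c \<in> carrier T"
  then obtain t where t: "t \<in> TP.terms" "c = TP.cls t"
    by (auto simp: carrier_tensor)
  have [simp]: "lie_eval A k t \<in> carrier A" if "t \<in> TP.terms" for t
    using that by (intro A.lie_eval_closed) (auto intro: closed)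
  from t(1) have "lie_eval A k (tensor_deriv l t) = aA l (lie_eval A k t)"
    unfolding tensor_deriv_def
    by induction (use l in \<open>auto simp: k A'.act_zero A'.act_neg A'.act_add_right
      A'.act_smult_right A'.act_bracket_right\<close>)
  then show "lie_lift A k (tensor_act R M aM mu N aN nu l c) = aA l (lie_lift A k c)"
    using l t by (simp add: tensor_act_cls lift_cls tensor_deriv_closed)
qed


section \<open>Crossed squares\<close>

context weak_crossed_square
begin

interpretation MN: crossed_pair R L M N aM aN mu nu
  by (intro crossed_pair.intro W1_crossed_modules)

interpretation PN: crossed_pair R L P N aP aN "mu \<circ> pM" nu
  by (intro crossed_pair.intro W1_crossed_modules)

interpretation MP: crossed_pair R L M P aM aP mu "mu \<circ> pM"
  by (intro crossed_pair.intro W1_crossed_modules)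

interpretation tensor: lie_pairing R L M N aM aN mu nu MN.T "\<lambda>(m, n). MN.tensor m n"
  by (rule MN.tensor_pairing)

text \<open>The boundary on \<open>P\<close> is the diagonal, so \<open>pM\<close> respects
  boundaries by definition; for \<open>pN\<close> below this is \<open>commutes\<close>.\<close>

interpretation pM_tensor_id:
  lie_pairing R L P N aP aN "mu \<circ> pM" nu MN.T "\<lambda>(p, n). MN.tensor (pM p) n"
  using MN.tensor_map_pairing[OF PN.crossed_pair_axioms, where f = pM and g = id]
  by (simp add: pM_hom id_in_lie_hom W1_equivariant lie_equivariant_id)

interpretation id_tensor_pN:
  lie_pairing R L M P aM aP mu "mu \<circ> pM" MN.T "\<lambda>(m, p). MN.tensor m (pN p)"
  using MN.tensor_map_pairing[OF MP.crossed_pair_axioms, where f = id and g = pN]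
  by (simp add: pN_hom id_in_lie_hom W1_equivariant commutes lie_equivariant_id)

text \<open>\<open>W2\<close>, \<open>W3\<close> and \<open>W4\<close> are read on generators. The
  restriction fixes the values off \<open>carrier M \<times> carrier N\<close>, about which the
  axioms say nothing.\<close>

lemma crossed_square_restrict:
  "crossed_square R L M N P aM aN aP mu nu pM pN
    (\<lambda>(m, n) \<in> carrier M \<times> carrier N. h (tensor_elt R M aM mu N aN nu m n))"
proof -
  note h = lie_homD[OF h_hom]
  have h_neg: "h (\<ominus>\<^bsub>MN.T\<^esub> t) = \<ominus>\<^bsub>P\<^esub> h t" if "t \<in> carrier MN.T" for t
    using that by (rule lie_hom_neg[OF MN.T.lie_algebra_axioms actP.M.lie_algebra_axioms h_hom])
  have h_diff: "h (s \<ominus>\<^bsub>MN.T\<^esub> t) = h s \<ominus>\<^bsub>P\<^esub> h t" if "s \<in> carrier MN.T" "t \<in> carrier MN.T" for s t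
    using that by (simp add: a_minus_def h h_neg)
  note [simp] = MN.tensor_elt_closed actM.M.bracket_closed actN.M.bracket_closed actP.act_closed
    lie_homD(1)[OF pM_hom] lie_homD(1)[OF pN_hom]
  have h_act: "aP l (h (MN.tensor m n)) = h (MN.tensor (aM l m) n) \<oplus>\<^bsub>P\<^esub> h (MN.tensor m (aN l n))"
    if "l \<in> carrier L" "m \<in> carrier M" "n \<in> carrier N" for l m n
  proof -
    have "aP l (h (MN.tensor m n)) = h (tensor_act R M aM mu N aN nu l (MN.tensor m n))"
      using W4 that by (simp add: lie_equivariant_def)
    then show ?thesis
      using that by (simp add: MN.tensor_act_tensor_elt h)
  qed
  show ?thesis
  proof (intro crossed_square.intro crossed_square_axioms.intro lie_square_axioms
      W1_equivariant W1_crossed_modules)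
    show "(\<lambda>(m, n)\<in>carrier M \<times> carrier N. h (MN.tensor m n)) \<in> carrier M \<times> carrier N \<rightarrow> carrier P"
      by (auto intro: h)
  next
    fix m n assume "m \<in> carrier M" "n \<in> carrier N"
    then show "pM ((\<lambda>(m, n)\<in>carrier M \<times> carrier N. h (MN.tensor m n)) (m, n)) = \<ominus>\<^bsub>M\<^esub> aM (nu n) m"
      using lie_pairing.lift_tensor_elt[OF MN.proj1_pairing] by (simp add: W2 tensor_proj1_def)
  next
    fix m n assume "m \<in> carrier M" "n \<in> carrier N"
    then show "pN ((\<lambda>(m, n)\<in>carrier M \<times> carrier N. h (MN.tensor m n)) (m, n)) = aN (mu m) n"
      using lie_pairing.lift_tensor_elt[OF MN.proj2_pairing] by (simp add: W2 tensor_proj2_def)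
  next
    fix p n assume "p \<in> carrier P" "n \<in> carrier N"
    then show "(\<lambda>(m, n)\<in>carrier M \<times> carrier N. h (MN.tensor m n)) (pM p, n) = \<ominus>\<^bsub>P\<^esub> aP (nu n) p"
      \<comment> \<open>On this generator \<open>tensor_map\<close> yields the tensor of
        \<open>pM p\<close> and \<open>n\<close>, and the first projection yields the right-hand
        side.\<close>
      using W3(1)[of "PN.tensor p n"] lie_pairing.lift_tensor_elt[OF PN.proj1_pairing]
      by (simp add: PN.tensor_elt_closed tensor_map_def tensor_proj1_def
          pM_tensor_id.lift_tensor_elt)
  next
    fix m p assume "m \<in> carrier M" "p \<in> carrier P"
    then show "(\<lambda>(m, n)\<in>carrier M \<times> carrier N. h (MN.tensor m n)) (m, pN p) = aP (mu m) p"
      using W3(2)[of "MP.tensor m p"] lie_pairing.lift_tensor_elt[OF MP.proj2_pairing]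
      by (simp add: MP.tensor_elt_closed tensor_map_def tensor_proj2_def
          id_tensor_pN.lift_tensor_elt)
  next
    fix m m' n assume [simp]: "m \<in> carrier M" "m' \<in> carrier M" "n \<in> carrier N"
    show "(\<lambda>(m, n)\<in>carrier M \<times> carrier N. h (MN.tensor m n)) (\<lbrace>m, m'\<rbrace>\<^bsub>M\<^esub>, n) =
        aP (mu m) ((\<lambda>(m, n)\<in>carrier M \<times> carrier N. h (MN.tensor m n)) (m', n)) \<ominus>\<^bsub>P\<^esub>
        aP (mu m') ((\<lambda>(m, n)\<in>carrier M \<times> carrier N. h (MN.tensor m n)) (m, n))"
      \<comment> \<open>Expanding the two actions with \<open>h_act\<close> and the Peiffer identity
        produces the bracket of \<open>m\<close> and \<open>m'\<close> in both orders, hence two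
        instances of the relation.\<close>
      using tensor.bracket_left[of m m' n] tensor.bracket_left[of m' m n]
      by (simp add: h_act h_diff h MN.aM_mu actP.M.M.diff_simps actP.M.M.a_ac)
  next
    fix m n n' assume [simp]: "m \<in> carrier M" "n \<in> carrier N" "n' \<in> carrier N"
    show "(\<lambda>(m, n)\<in>carrier M \<times> carrier N. h (MN.tensor m n)) (m, \<lbrace>n, n'\<rbrace>\<^bsub>N\<^esub>) =
        aP (nu n) ((\<lambda>(m, n)\<in>carrier M \<times> carrier N. h (MN.tensor m n)) (m, n')) \<ominus>\<^bsub>P\<^esub>
        aP (nu n') ((\<lambda>(m, n)\<in>carrier M \<times> carrier N. h (MN.tensor m n)) (m, n))"
      using tensor.bracket_right[of m n n'] tensor.bracket_right[of m n' n]
      by (simp add: h_act h_diff h MN.NX.peiffer actP.M.M.diff_simps actP.M.M.a_ac)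
  qed (use tensor.add_left tensor.add_right tensor.smult_left tensor.smult_right in
      \<open>simp_all add: h h_act\<close>)
qed

end

section \<open>From crossed squares to weak crossed squares\<close>

context crossed_square
begin

interpretation MN: crossed_pair R L M N aM aN mu nu
  by (intro crossed_pair.intro X1_crossed_modules)

interpretation PN: crossed_pair R L P N aP aN "mu \<circ> pM" nu
  by (intro crossed_pair.intro X1_crossed_modules)

interpretation MP: crossed_pair R L M P aM aP mu "mu \<circ> pM"
  by (intro crossed_pair.intro X1_crossed_modules)

interpretation pM_tensor_id:
  lie_pairing R L P N aP aN "mu \<circ> pM" nu MN.T "\<lambda>(p, n). MN.tensor (pM p) n"
  using MN.tensor_map_pairing[OF PN.crossed_pair_axioms, where f = pM and g = id]
  by (simp add: pM_hom id_in_lie_hom X1_equivariant lie_equivariant_id)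

interpretation id_tensor_pN:
  lie_pairing R L M P aM aP mu "mu \<circ> pM" MN.T "\<lambda>(m, p). MN.tensor m (pN p)"
  using MN.tensor_map_pairing[OF MP.crossed_pair_axioms, where f = id and g = pN]
  by (simp add: pN_hom id_in_lie_hom X1_equivariant commutes lie_equivariant_id)

lemma h_in: "\<lbrakk>m \<in> carrier M; n \<in> carrier N\<rbrakk> \<Longrightarrow> h (m, n) \<in> carrier P"
  using h_closed by auto

text \<open>The gap to close is between the bracket clauses of \<open>X0\<close>, which use the
  action on \<open>P\<close>, and the tensor relations, which use the actions inside the arguments
  of \<open>h\<close>.\<close>

lemma h_pairing: "lie_pairing R L M N aM aN mu nu P h"
proof (intro lie_pairing.intro lie_pairing_axioms.intro MN.crossed_pair_axioms
    actP.M.lie_algebra_axioms h_in X0_add_left X0_add_right X0_smult_left X0_smult_right)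
  note [simp] = actM.M.bracket_closed actN.M.bracket_closed actP.M.bracket_closed h_in
  fix m n assume [simp]: "m \<in> carrier M" "n \<in> carrier N"
  have neg: "h (\<ominus>\<^bsub>M\<^esub> m, n) = \<ominus>\<^bsub>P\<^esub> h (m, n)" if [simp]: "m \<in> carrier M" "n \<in> carrier N" for m n
  proof -
    have "h (\<zero>\<^bsub>M\<^esub>, n) = \<zero>\<^bsub>P\<^esub>"
      using X0_add_left[of "\<zero>\<^bsub>M\<^esub>" "\<zero>\<^bsub>M\<^esub>" n] by (simp add: actP.M.M.add.r_cancel_one')
    then show ?thesis
      using X0_add_left[of "\<ominus>\<^bsub>M\<^esub> m" m n] by (simp add: actM.M.M.l_neg actP.M.M.minus_equality)
  qed
  {
    fix m' n' assume [simp]: "m' \<in> carrier M" "n' \<in> carrier N"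
    \<comment> \<open>The Peiffer identity in \<open>P\<close> turns the bracket into an action
      through the diagonal, and \<open>X3\<close> turns that action back into a value of
      \<open>h\<close>.\<close>
    have "\<lbrace>h (m, n), h (m', n')\<rbrace>\<^bsub>P\<^esub> = aP (mu (pM (h (m, n)))) (h (m', n'))"
      using lie_crossed_module.peiffer[OF X1_crossed_modules(3)] by simp
    also have "\<dots> = h (pM (h (m, n)), pN (h (m', n')))"
      using lie_homD(1)[OF pM_hom] by (simp add: X3)
    finally show "\<lbrace>h (m, n), h (m', n')\<rbrace>\<^bsub>P\<^esub> = \<ominus>\<^bsub>P\<^esub> h (aM (nu n) m, aN (mu m') n')"
      by (simp add: X2 neg)
  }
  {
    fix m' assume [simp]: "m' \<in> carrier M"
    \<comment> \<open>\<open>X0_bracket_left\<close> expanded by \<open>X4\<close>: both actions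
      contribute the bracket value, the second with opposite sign by antisymmetry. Cancelling one
      copy avoids any division by 2.\<close>
    have "h (m, aN (mu m') n) \<oplus>\<^bsub>P\<^esub> h (\<lbrace>m, m'\<rbrace>\<^bsub>M\<^esub>, n) =
        (h (m', aN (mu m) n) \<oplus>\<^bsub>P\<^esub> h (\<lbrace>m, m'\<rbrace>\<^bsub>M\<^esub>, n)) \<oplus>\<^bsub>P\<^esub> h (\<lbrace>m, m'\<rbrace>\<^bsub>M\<^esub>, n)"
      using X0_bracket_left[of m m' n] actM.M.bracket_antisym[of m m']
      by (simp add: X4 MN.aM_mu neg actP.M.M.diff_simps actP.M.M.a_ac)
    then have "h (m, aN (mu m') n) = h (m', aN (mu m) n) \<oplus>\<^bsub>P\<^esub> h (\<lbrace>m, m'\<rbrace>\<^bsub>M\<^esub>, n)"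
      by (simp add: actP.M.M.add.right_cancel)
    then show "h (\<lbrace>m, m'\<rbrace>\<^bsub>M\<^esub>, n) = h (m, aN (mu m') n) \<ominus>\<^bsub>P\<^esub> h (m', aN (mu m) n)"
      by (simp add: actP.M.M.diff_simps actP.M.M.a_comm)
  }
  {
    fix n' assume [simp]: "n' \<in> carrier N"
    \<comment> \<open>The sign is read off \<open>X0_bracket_right\<close>, whose right-hand side
      changes sign when \<open>n\<close> and \<open>n'\<close> are exchanged.\<close>
    have "h (m, \<lbrace>n', n\<rbrace>\<^bsub>N\<^esub>) = \<ominus>\<^bsub>P\<^esub> h (m, \<lbrace>n, n'\<rbrace>\<^bsub>N\<^esub>)"
      using X0_bracket_right[of m n n'] X0_bracket_right[of m n' n]
      by (simp add: actP.M.M.neg_diff actP.act_closed)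
    moreover have "h (m, \<lbrace>n, n'\<rbrace>\<^bsub>N\<^esub>) = (h (aM (nu n) m, n') \<oplus>\<^bsub>P\<^esub> h (m, \<lbrace>n, n'\<rbrace>\<^bsub>N\<^esub>))
        \<ominus>\<^bsub>P\<^esub> (h (aM (nu n') m, n) \<oplus>\<^bsub>P\<^esub> h (m, \<lbrace>n', n\<rbrace>\<^bsub>N\<^esub>))"
      \<comment> \<open>Only the left-hand occurrence is rewritten; the brackets on the right
        reappear from \<open>X4\<close> and the Peiffer identity.\<close>
      by (subst X0_bracket_right) (simp_all add: X4 MN.NX.peiffer)
    ultimately have "h (aM (nu n') m, n) \<oplus>\<^bsub>P\<^esub> h (m, \<lbrace>n, n'\<rbrace>\<^bsub>N\<^esub>) =
        (h (aM (nu n) m, n') \<oplus>\<^bsub>P\<^esub> h (m, \<lbrace>n, n'\<rbrace>\<^bsub>N\<^esub>)) \<oplus>\<^bsub>P\<^esub> h (m, \<lbrace>n, n'\<rbrace>\<^bsub>N\<^esub>)"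
      by (simp add: actP.M.M.diff_simps actP.M.M.a_ac)
    then have "h (aM (nu n') m, n) = h (aM (nu n) m, n') \<oplus>\<^bsub>P\<^esub> h (m, \<lbrace>n, n'\<rbrace>\<^bsub>N\<^esub>)"
      by (simp add: actP.M.M.add.right_cancel)
    then show "h (m, \<lbrace>n, n'\<rbrace>\<^bsub>N\<^esub>) = h (aM (nu n') m, n) \<ominus>\<^bsub>P\<^esub> h (aM (nu n) m, n')"
      by (simp add: actP.M.M.diff_simps actP.M.M.a_comm)
  }
qed

interpretation H: lie_pairing R L M N aM aN mu nu P h
  by (rule h_pairing)

text \<open>The morphism is the one induced by the pairing \<open>h\<close>. \<open>W2\<close> and
  \<open>W3\<close> compare morphisms out of tensor products, so generators suffice, where they
  become \<open>X2\<close> and \<open>X3\<close>.\<close>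

lemma weak_crossed_square_lift:
  "weak_crossed_square R L M N P aM aN aP mu nu pM pN
    (restrict (lie_lift P h) (carrier (lie_tensor R M aM mu N aN nu)))"
proof (intro weak_crossed_square.intro weak_crossed_square_axioms.intro lie_square_axioms
    X1_equivariant X1_crossed_modules)
  note [simp] = MN.T.bracket_closed MN.tensor_act_closed MN.tensor_elt_closed
    lie_homD(1)[OF pM_hom] lie_homD(1)[OF pN_hom] h_in
  show "restrict (lie_lift P h) (carrier MN.T) \<in> lie_hom R MN.T P"
    using H.lift_hom unfolding lie_hom_def by auto
  show "lie_equivariant L MN.T (tensor_act R M aM mu N aN nu) aP
      (restrict (lie_lift P h) (carrier MN.T))"
    using H.lift_equivariant[OF actP.lie_action_axioms X4] by (simp add: lie_equivariant_def)
  fix t assume t: "t \<in> carrier MN.T"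
  interpret proj1: lie_pairing R L M N aM aN mu nu M "\<lambda>(m, n). \<ominus>\<^bsub>M\<^esub> aM (nu n) m"
    by (rule MN.proj1_pairing)
  interpret proj2: lie_pairing R L M N aM aN mu nu N "\<lambda>(m, n). aN (mu m) n"
    by (rule MN.proj2_pairing)
  have "pM (lie_lift P h t) = tensor_proj1 M aM nu t"
    unfolding tensor_proj1_def
    by (rule MN.tensor_hom_eqI[OF actM.M.lie_algebra_axioms lie_hom_comp[OF H.lift_hom pM_hom]
          proj1.lift_hom _ t]) (simp add: H.lift_tensor_elt proj1.lift_tensor_elt X2)
  with t show "pM (restrict (lie_lift P h) (carrier MN.T) t) = tensor_proj1 M aM nu t"
    by simp
  have "pN (lie_lift P h t) = tensor_proj2 N aN mu t"
    unfolding tensor_proj2_def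
    by (rule MN.tensor_hom_eqI[OF actN.M.lie_algebra_axioms lie_hom_comp[OF H.lift_hom pN_hom]
          proj2.lift_hom _ t]) (simp add: H.lift_tensor_elt proj2.lift_tensor_elt X2)
  with t show "pN (restrict (lie_lift P h) (carrier MN.T) t) = tensor_proj2 N aN mu t"
    by simp
next
  note [simp] = MN.tensor_elt_closed lie_homD(1)[OF pM_hom] lie_homD(1)[OF pN_hom] h_in
  interpret proj1: lie_pairing R L P N aP aN "mu \<circ> pM" nu P "\<lambda>(p, n). \<ominus>\<^bsub>P\<^esub> aP (nu n) p"
    by (rule PN.proj1_pairing)
  fix u assume u: "u \<in> carrier PN.T"
  have "lie_lift P h (tensor_map R M aM mu N aN nu pM id u) = tensor_proj1 P aP nu u"
    unfolding tensor_proj1_def tensor_map_def id_apply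
    by (rule PN.tensor_hom_eqI[OF actP.M.lie_algebra_axioms
          lie_hom_comp[OF pM_tensor_id.lift_hom H.lift_hom] proj1.lift_hom _ u])
      (simp add: H.lift_tensor_elt proj1.lift_tensor_elt pM_tensor_id.lift_tensor_elt X3)
  \<comment> \<open>The restricted lift agrees with the lift only on the carrier, so
    \<open>tensor_map\<close> must be known to land there.\<close>
  moreover have "tensor_map R M aM mu N aN nu pM id u \<in> carrier MN.T"
    unfolding tensor_map_def id_apply using pM_tensor_id.lift_hom u by (rule lie_homD)
  ultimately show "restrict (lie_lift P h) (carrier MN.T) (tensor_map R M aM mu N aN nu pM id u) =
      tensor_proj1 P aP nu u"
    by simp
next
  note [simp] = MN.tensor_elt_closed lie_homD(1)[OF pM_hom] lie_homD(1)[OF pN_hom] h_in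
  interpret proj2: lie_pairing R L M P aM aP mu "mu \<circ> pM" P "\<lambda>(m, p). aP (mu m) p"
    by (rule MP.proj2_pairing)
  fix v assume v: "v \<in> carrier MP.T"
  have "lie_lift P h (tensor_map R M aM mu N aN nu id pN v) = tensor_proj2 P aP mu v"
    unfolding tensor_proj2_def tensor_map_def id_apply
    by (rule MP.tensor_hom_eqI[OF actP.M.lie_algebra_axioms
          lie_hom_comp[OF id_tensor_pN.lift_hom H.lift_hom] proj2.lift_hom _ v])
      (simp add: H.lift_tensor_elt proj2.lift_tensor_elt id_tensor_pN.lift_tensor_elt X3)
  moreover have "tensor_map R M aM mu N aN nu id pN v \<in> carrier MN.T"
    unfolding tensor_map_def id_apply using id_tensor_pN.lift_hom v by (rule lie_homD)
  ultimately show "restrict (lie_lift P h) (carrier MN.T) (tensor_map R M aM mu N aN nu id pN v) =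
      tensor_proj2 P aP mu v"
    by simp
qed

end

text \<open>That the two notions coincide is expressed as a bijection between the maps
  \<open>h\<close>. Extensionality on both sides excludes arbitrary values off the carriers, which
  would spoil injectivity.\<close>

theorem proposition8p6:
  fixes R :: "('r, 'u) ring_scheme"
    and L :: "('r, 'l, 'v) lie_algebra_scheme"
    and M :: "('r, 'm, 'w) lie_algebra_scheme"
    and N :: "('r, 'n, 'x) lie_algebra_scheme"
    and P :: "('r, 'p, 'y) lie_algebra_scheme"
    and aM :: "'l \<Rightarrow> 'm \<Rightarrow> 'm" and aN :: "'l \<Rightarrow> 'n \<Rightarrow> 'n" and aP :: "'l \<Rightarrow> 'p \<Rightarrow> 'p"
    and mu :: "'m \<Rightarrow> 'l" and nu :: "'n \<Rightarrow> 'l" and pM :: "'p \<Rightarrow> 'm" and pN :: "'p \<Rightarrow> 'n"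
  assumes "cring R"
    and "lie_square R L M N P aM aN aP mu nu pM pN"
  shows "bij_betw
    (\<lambda>h. \<lambda>(m, n) \<in> carrier M \<times> carrier N. h (tensor_elt R M aM mu N aN nu m n))
    {h \<in> extensional (carrier (lie_tensor R M aM mu N aN nu)).
       weak_crossed_square R L M N P aM aN aP mu nu pM pN h}
    {h \<in> extensional (carrier M \<times> carrier N).
       crossed_square R L M N P aM aN aP mu nu pM pN h}"
proof (rule bij_betwI[where g = "\<lambda>k. restrict (lie_lift P k) (carrier (lie_tensor R M aM mu N aN nu))"])
  fix h assume "h \<in> {h \<in> extensional (carrier (lie_tensor R M aM mu N aN nu)).
       weak_crossed_square R L M N P aM aN aP mu nu pM pN h}"
  then have ext: "h \<in> extensional (carrier (lie_tensor R M aM mu N aN nu))"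
    and "weak_crossed_square R L M N P aM aN aP mu nu pM pN h" by auto
  interpret h: weak_crossed_square R L M N P aM aN aP mu nu pM pN h by fact
  let ?k = "\<lambda>(m, n) \<in> carrier M \<times> carrier N. h (tensor_elt R M aM mu N aN nu m n)"
  interpret k: crossed_square R L M N P aM aN aP mu nu pM pN ?k
    by (rule h.crossed_square_restrict)
  interpret K: lie_pairing R L M N aM aN mu nu P ?k
    by (rule k.h_pairing)
  \<comment> \<open>Both are morphisms on the tensor product with the same values on
    generators.\<close>
  have "lie_lift P ?k c = h c" if "c \<in> carrier K.T" for c
    using that
    by (rule K.tensor_hom_eqI[OF h.actP.M.lie_algebra_axioms K.lift_hom h.h_hom, rotated])
      (simp add: K.lift_tensor_elt)
  then show "restrict (lie_lift P ?k) (carrier K.T) = h"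
    using ext by (auto simp: extensional_def)
next
  fix k assume "k \<in> {h \<in> extensional (carrier M \<times> carrier N).
       crossed_square R L M N P aM aN aP mu nu pM pN h}"
  then have ext: "k \<in> extensional (carrier M \<times> carrier N)"
    and "crossed_square R L M N P aM aN aP mu nu pM pN k" by auto
  interpret k: crossed_square R L M N P aM aN aP mu nu pM pN k by fact
  interpret K: lie_pairing R L M N aM aN mu nu P k
    by (rule k.h_pairing)
  show "(\<lambda>(m, n) \<in> carrier M \<times> carrier N.
      restrict (lie_lift P k) (carrier K.T) (tensor_elt R M aM mu N aN nu m n)) = k"
    using ext by (auto simp: extensional_def K.lift_tensor_elt K.tensor_elt_closed)
qed (auto intro: weak_crossed_square.crossed_square_restrict crossed_square.weak_crossed_square_lift)

end
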